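(* Let $Y_i=\sum_{r}\ell_{ir}\partial_r$ ($i\in\{1,\ldots,n\}$, $\ell\in\mathfrak{gl}(n,\mathbb{R}^{n*})$) be $n$ mutually commuting linear vector fields in $\mathbb{R}^n$ with $D=\det\ell\neq0$. Let $\Lambda=\sum_{i<j}\alpha^{ij}\,Y_i\wedge Y_j$ with $\alpha^{ij}\in\mathbb{R}$, set $\alpha^{ji}=-\alpha^{ij}$, $X_i=\sum_{j\neq i}\alpha^{ij}Y_j$, and $\delta_i=\operatorname{div}X_i\in\mathbb{R}$. Let $\partial_\Lambda=[\Lambda,\cdot]_{\mathrm{SN}}$. (i) Let $C=D^{-1}\sum_{\mathbf{k}}P^{\mathbf{k}r}Y_{\mathbf{k}}\in\mathcal{P}^{pr}$ be a homogeneous potential cochain. Then $$\partial_\Lambda C=\sum_{\mathbf{k},i}X_i\!\left(D^{-1}P^{\mathbf{k}r}\right)Y_i\wedge Y_{\mathbf{k}}=D^{-1}\sum_{\mathbf{k},i}\left(X_i-\delta_i\operatorname{id}\right)(P^{\mathbf{k}r})\;Y_i\wedge Y_{\mathbf{k}}\in\mathcal{P}^{p+1,r}.$$ (ii) The operator $\partial_\Lambda$ endows $\mathcal{P}$ with a differential complex structure and preserves the polynomial degree $r$. This complex $(\mathcal{P},\partial_\Lambda)$ contains the Lichnerowicz-Poisson complex $(\mathcal{R},\partial_\Lambda)$ as a differential subcomplex.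
   Context: $\mathcal{S}^r\mathbb{R}^{n*}$ is the space of homogeneous polynomials of degree $r$ on $\mathbb{R}^n$; $\mathbf{k}=(k_1<\cdots<k_p)$ and $Y_{\mathbf{k}}=Y_{k_1}\wedge\cdots\wedge Y_{k_p}$. Real formal cochains: $\mathcal{R}=\bigoplus_{p=0}^n\mathbb{R}[[x_1,\ldots,x_n]]\otimes\bigwedge^p\langle\partial_1,\ldots,\partial_n\rangle$. Potential formal cochains: $\mathcal{P}=D^{-1}\bigoplus_{p=0}^n\mathbb{R}[[x_1,\ldots,x_n]]\otimes\bigwedge^p\langle Y_1,\ldots,Y_n\rangle$, with homogeneous components $\mathcal{P}^{pr}=D^{-1}\mathcal{S}^r\mathbb{R}^{n*}\otimes\bigwedge^p\langle Y_1,\ldots,Y_n\rangle$ ($p$ is the exterior degree, $r$ the polynomial degree). Since $\partial_j=D^{-1}\sum_k\mathbf{L}_{kj}Y_k$ ($\mathbf{L}$ the cofactor matrix of $\ell$), $\mathcal{R}$ is canonically a subspace of $\mathcal{P}$. $[\cdot,\cdot]_{\mathrm{SN}}$ is the Schouten-Nijenhuis bracket, with conventions: it is the Lie bracket on vector fields, $[X,f]_{\mathrm{SN}}=Xf$, $[P,Q]=-(-1)^{(p-1)(q-1)}[Q,P]$ and $[P,Q\wedge R]=[P,Q]\wedge R+(-1)^{(p-1)q}Q\wedge[P,R]$ for polyvectors of degrees $p,q$; thus $[Y_i\wedge Y_j,f]_{\mathrm{SN}}=(Y_jf)Y_i-(Y_if)Y_j$. It is extended to coefficients in $D^{-1}\mathbb{R}[[x_1,\ldots,x_n]]$.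 The Lichnerowicz-Poisson complex of $\Lambda$ is $\mathcal{R}$ with differential $\partial_\Lambda=[\Lambda,\cdot]_{\mathrm{SN}}$. $\operatorname{div}$ is the standard divergence on $\mathbb{R}^n$. *)

theory Defs
  imports
    "HOL-Analysis.Determinants"
    "HOL-Library.Poly_Mapping"
    "HOL-Computational_Algebra.Fraction_Field"
begin

section \<open>Formal power series in several variables\<close>

text \<open>
  The index type \<open>'n\<close> plays the role of \<open>{1, \<dots>, n}\<close>; a power series is the family of its
  coefficients, indexed by multi-exponents.
\<close>

typedef 'n mps = "UNIV :: (('n \<Rightarrow>\<^sub>0 nat) \<Rightarrow> real) set"
  morphisms mps_nth Abs_mps ..

setup_lifting type_definition_mps

lemma mps_eqI: "(\<And>m. mps_nth f m = mps_nth g m) \<Longrightarrow> f = g"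
  by transfer auto

lemma finite_antidiagonal:
  fixes m :: "'n::finite \<Rightarrow>\<^sub>0 nat"
  shows "finite {(a, b). a + b = m}"
proof -
  have "finite (Poly_Mapping.lookup ` {a. \<forall>i. Poly_Mapping.lookup a i \<le> Poly_Mapping.lookup m i})"
    by (rule finite_subset[of _ "PiE UNIV (\<lambda>i. {..Poly_Mapping.lookup m i})"]) (auto intro!: finite_PiE)
  then have fin: "finite {a. \<forall>i. Poly_Mapping.lookup a i \<le> Poly_Mapping.lookup m i}"
    by (rule finite_imageD) (simp add: inj_on_def lookup_inject)
  have "{(a, b). a + b = m} \<subseteq> {a. \<forall>i. Poly_Mapping.lookup a i \<le> Poly_Mapping.lookup m i} \<times> {a. \<forall>i. Poly_Mapping.lookup a i \<le> Poly_Mapping.lookup m i}"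
    by (auto simp: lookup_add)
  then show ?thesis
    using fin by (meson finite_SigmaI finite_subset)
qed

lemma finite_antidiagonal':
  fixes m :: "'n::finite \<Rightarrow>\<^sub>0 nat"
  shows "finite {p. fst p + snd p = m}"
  using finite_antidiagonal[of m] by (simp add: case_prod_unfold)

instantiation mps :: ("{finite,linorder}") comm_ring_1
begin

lift_definition zero_mps :: "'a mps" is "\<lambda>m. 0" .
lift_definition one_mps :: "'a mps" is "\<lambda>m. if m = 0 then 1 else 0" .
lift_definition plus_mps :: "'a mps \<Rightarrow> 'a mps \<Rightarrow> 'a mps" is "\<lambda>f g m. f m + g m" .
lift_definition minus_mps :: "'a mps \<Rightarrow> 'a mps \<Rightarrow> 'a mps" is "\<lambda>f g m. f m - g m" .
lift_definition uminus_mps :: "'a mps \<Rightarrow> 'a mps" is "\<lambda>f m. - f m" .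
lift_definition times_mps :: "'a mps \<Rightarrow> 'a mps \<Rightarrow> 'a mps"
  is "\<lambda>f g m. \<Sum>(a, b)\<in>{(a, b). a + b = m}. f a * g b" .

instance
proof
  fix f g h :: "'a mps"
  show "f * g * h = f * (g * h)"
  proof (rule mps_eqI)
    fix m :: "'a \<Rightarrow>\<^sub>0 nat"
    let ?T = "{(a, b, c). a + b + c = m}"
    have "mps_nth (f * g * h) m
        = (\<Sum>(d, c)\<in>{(d, c). d + c = m}. \<Sum>(a, b)\<in>{(a, b). a + b = d}. mps_nth f a * mps_nth g b * mps_nth h c)"
      by (simp add: times_mps.rep_eq sum_distrib_right case_prod_unfold)
    also have "\<dots> = (\<Sum>(x, y)\<in>(SIGMA x:{(d, c). d + c = m}. {(a, b). a + b = fst x}).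
        mps_nth f (fst y) * mps_nth g (snd y) * mps_nth h (snd x))"
      by (subst sum.Sigma[symmetric]) (auto simp: finite_antidiagonal' case_prod_unfold)
    also have "\<dots> = (\<Sum>(a, b, c)\<in>?T. mps_nth f a * mps_nth g b * mps_nth h c)"
      by (rule sum.reindex_bij_witness[of _ "\<lambda>(a, b, c). ((a + b, c), (a, b))" "\<lambda>((d, c), (a, b)). (a, b, c)"]) auto
    also have "\<dots> = (\<Sum>(x, y)\<in>(SIGMA x:{(a, d). a + d = m}. {(b, c). b + c = snd x}).
        mps_nth f (fst x) * mps_nth g (fst y) * mps_nth h (snd y))"
      by (rule sum.reindex_bij_witness[of _ "\<lambda>((a, d), (b, c)). (a, b, c)" "\<lambda>(a, b, c). ((a, b + c), (b, c))"])
        (auto simp: add.assoc)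
    also have "\<dots> = (\<Sum>(a, d)\<in>{(a, d). a + d = m}. \<Sum>(b, c)\<in>{(b, c). b + c = d}. mps_nth f a * mps_nth g b * mps_nth h c)"
      by (subst sum.Sigma[symmetric]) (auto simp: finite_antidiagonal' case_prod_unfold)
    also have "\<dots> = mps_nth (f * (g * h)) m"
      by (simp add: times_mps.rep_eq sum_distrib_left case_prod_unfold mult.assoc)
    finally show "mps_nth (f * g * h) m = mps_nth (f * (g * h)) m" .
  qed
  show "f * g = g * f"
  proof (rule mps_eqI)
    fix m :: "'a \<Rightarrow>\<^sub>0 nat"
    show "mps_nth (f * g) m = mps_nth (g * f) m"
      unfolding times_mps.rep_eq
      by (rule sum.reindex_bij_witness[of _ prod.swap prod.swap]) (auto simp: ac_simps)
  qed
  show "1 * f = f"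
  proof (rule mps_eqI)
    fix m :: "'a \<Rightarrow>\<^sub>0 nat"
    have "mps_nth (1 * f) m
        = (\<Sum>x\<in>{(a, b). a + b = m}. if x = (0, m) then mps_nth f m else 0)"
      unfolding times_mps.rep_eq one_mps.rep_eq by (rule sum.cong) (auto split: if_splits)
    then show "mps_nth (1 * f) m = mps_nth f m"
      by (simp add: finite_antidiagonal sum.delta)
  qed
  show "(f + g) * h = f * h + g * h"
    by (rule mps_eqI)
      (simp add: times_mps.rep_eq plus_mps.rep_eq distrib_right sum.distrib case_prod_unfold)
  show "(0::'a mps) \<noteq> 1"
    by transfer (metis zero_neq_one)
qed (transfer; simp add: fun_eq_iff algebra_simps)+

end

definition total_degree :: "('n::finite \<Rightarrow>\<^sub>0 nat) \<Rightarrow> nat" where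
  "total_degree m = (\<Sum>i\<in>UNIV. Poly_Mapping.lookup m i)"

lemma total_degree_add: "total_degree (a + b) = total_degree a + total_degree b"
  by (simp add: total_degree_def lookup_add sum.distrib)

lemma finite_total_degree: "finite {m :: 'n::finite \<Rightarrow>\<^sub>0 nat. total_degree m = d}"
proof -
  have le: "Poly_Mapping.lookup m i \<le> total_degree m" for m :: "'n \<Rightarrow>\<^sub>0 nat" and i
    unfolding total_degree_def by (rule member_le_sum) auto
  have "finite (Poly_Mapping.lookup ` {m :: 'n \<Rightarrow>\<^sub>0 nat. total_degree m = d})"
    by (rule finite_subset[of _ "PiE UNIV (\<lambda>i. {..d})"]) (use le in \<open>auto intro!: finite_PiE\<close>)
  then show ?thesis
    by (rule finite_imageD) (simp add: inj_on_def lookup_inject)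
qed

instance mps :: ("{finite,linorder}") idom
proof
  fix f g :: "'a mps"
  assume "f \<noteq> 0" "g \<noteq> 0"
  have lead: "\<exists>a. mps_nth h a \<noteq> 0 \<and> (\<forall>b. mps_nth h b \<noteq> 0 \<longrightarrow> total_degree a < total_degree b
      \<or> total_degree a = total_degree b \<and> a \<le> b)" if h: "h \<noteq> 0" for h :: "'a mps"
  proof -
    from h have "\<exists>a. mps_nth h a \<noteq> 0"
      by (metis mps_eqI zero_mps.rep_eq)
    then obtain a where a: "mps_nth h a \<noteq> 0"
      and min: "\<And>b. mps_nth h b \<noteq> 0 \<Longrightarrow> total_degree a \<le> total_degree b"
      using ex_has_least_nat[of "\<lambda>a. mps_nth h a \<noteq> 0" _ total_degree] by blast
    define S where "S = {b. mps_nth h b \<noteq> 0 \<and> total_degree b = total_degree a}"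
    have S: "finite S" "S \<noteq> {}"
      using finite_total_degree[of "total_degree a"] a by (auto simp: S_def)
    have "Min S \<in> S" and "\<And>b. b \<in> S \<Longrightarrow> Min S \<le> b"
      using S by simp_all
    then have Min: "mps_nth h (Min S) \<noteq> 0" "total_degree (Min S) = total_degree a"
      and le: "\<And>b. mps_nth h b \<noteq> 0 \<Longrightarrow> total_degree b = total_degree a \<Longrightarrow> Min S \<le> b"
      unfolding S_def by blast+
    show ?thesis
    proof (intro exI[of _ "Min S"] conjI allI impI)
      fix b
      assume b: "mps_nth h b \<noteq> 0"
      show "total_degree (Min S) < total_degree b \<or> total_degree (Min S) = total_degree b \<and> Min S \<le> b"
        using min[OF b] le[OF b] Min(2) by linarith
    qed (fact Min(1))
  qed
  obtain a where a: "mps_nth f a \<noteq> 0" "\<And>b. mps_nth f b \<noteq> 0 \<Longrightarrow> total_degree a < total_degree b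
      \<or> total_degree a = total_degree b \<and> a \<le> b"
    using lead[OF \<open>f \<noteq> 0\<close>] by blast
  obtain c where c: "mps_nth g c \<noteq> 0" "\<And>b. mps_nth g b \<noteq> 0 \<Longrightarrow> total_degree c < total_degree b
      \<or> total_degree c = total_degree b \<and> c \<le> b"
    using lead[OF \<open>g \<noteq> 0\<close>] by blast
  have unique: "a' = a \<and> c' = c" if eq: "a' + c' = a + c" and nz: "mps_nth f a' \<noteq> 0" "mps_nth g c' \<noteq> 0" for a' c'
  proof -
    have "total_degree a' + total_degree c' = total_degree a + total_degree c"
      using arg_cong[OF eq, of total_degree] by (simp add: total_degree_add)
    then have le: "a \<le> a'" "c \<le> c'"
      using a(2)[OF nz(1)] c(2)[OF nz(2)] by linarith+
    have "\<not> a < a'"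
      using add_less_le_mono[of a a' c c'] le(2) eq by auto
    with le(1) have "a' = a"
      by simp
    with eq show ?thesis
      by simp
  qed
  have "mps_nth (f * g) (a + c)
      = (\<Sum>x\<in>{(a', c'). a' + c' = a + c}. if x = (a, c) then mps_nth f a * mps_nth g c else 0)"
    unfolding times_mps.rep_eq by (rule sum.cong) (use unique in auto)
  also have "\<dots> = mps_nth f a * mps_nth g c"
    by (simp add: finite_antidiagonal sum.delta)
  finally have "mps_nth (f * g) (a + c) \<noteq> 0"
    using a(1) c(1) by simp
  then show "f * g \<noteq> 0"
    by (metis zero_mps.rep_eq)
qed

lift_definition mps_const :: "real \<Rightarrow> 'n mps" is "\<lambda>c m. if m = 0 then c else 0" .

lift_definition mps_deriv :: "'n \<Rightarrow> 'n mps \<Rightarrow> 'n mps"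
  is "\<lambda>i f m. real (Poly_Mapping.lookup m i + 1) * f (m + Poly_Mapping.single i 1)" .

lift_definition mps_hom_part :: "nat \<Rightarrow> 'n::finite mps \<Rightarrow> 'n mps"
  is "\<lambda>r f m. if total_degree m = r then f m else 0" .

text \<open>A homogeneous polynomial of degree \<open>r\<close> is a power series concentrated in degree \<open>r\<close>; as there
  are finitely many variables, it has finitely many nonzero coefficients.\<close>

definition hom_polys :: "nat \<Rightarrow> 'n::finite mps set" where
  "hom_polys r = {f. \<forall>m. mps_nth f m \<noteq> 0 \<longrightarrow> total_degree m = r}"

lemma mps_const_add: "mps_const (a + b) = mps_const a + mps_const b"
  by transfer auto

lemma mps_const_1: "mps_const 1 = 1"
  by transfer auto

lemma mps_const_mult_nth:
  fixes f :: "'n::{finite,linorder} mps"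
  shows "mps_nth (mps_const c * f) m = c * mps_nth f m"
proof -
  have "mps_nth (mps_const c * f) m
      = (\<Sum>x\<in>{(a, b). a + b = m}. if x = (0, m) then c * mps_nth f m else 0)"
    unfolding times_mps.rep_eq mps_const.rep_eq by (rule sum.cong) (auto split: if_splits)
  then show ?thesis
    by (simp add: finite_antidiagonal sum.delta)
qed

lemma mps_const_mult: "mps_const (a * b) = mps_const a * (mps_const b :: 'n::{finite,linorder} mps)"
  by (rule mps_eqI) (simp add: mps_const_mult_nth mps_const.rep_eq)

lemma mps_deriv_add: "mps_deriv i (f + g) = mps_deriv i f + mps_deriv i g"
  by (rule mps_eqI) (simp add: mps_deriv.rep_eq plus_mps.rep_eq distrib_left)

lemma mps_deriv_mult:
  fixes f g :: "'n::{finite,linorder} mps"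
  shows "mps_deriv i (f * g) = mps_deriv i f * g + f * mps_deriv i g"
proof (rule mps_eqI)
  fix m :: "'n \<Rightarrow>\<^sub>0 nat"
  let ?e = "Poly_Mapping.single i (1::nat)"
  let ?A = "{(a, b). a + b = m + ?e}"
  have e: "a - ?e + ?e = a" if "Poly_Mapping.lookup a i \<noteq> 0" for a
  proof (rule poly_mapping_eqI)
    fix k show "Poly_Mapping.lookup (a - ?e + ?e) k = Poly_Mapping.lookup a k"
      using that by (cases "k = i") (auto simp: lookup_add lookup_minus lookup_single)
  qed
  have sub: "a - ?e + b = m" if "a + b = m + ?e" "Poly_Mapping.lookup a i \<noteq> 0" for a b
  proof -
    have "(a - ?e + b) + ?e = (a - ?e + ?e) + b"
      by (simp only: add.assoc add.commute[of b])
    then have "(a - ?e + b) + ?e = m + ?e"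
      using e[OF that(2)] that(1) by simp
    then show ?thesis
      by (rule add_right_imp_eq)
  qed
  have lookup_e: "Poly_Mapping.lookup (a + ?e) i = Poly_Mapping.lookup a i + 1" for a
    by (simp add: lookup_add)
  have deriv: "(\<Sum>(a, b)\<in>?A. real (Poly_Mapping.lookup a i) * (mps_nth h a * mps_nth k b))
      = mps_nth (mps_deriv i h * k) m" for h k :: "'n mps"
  proof -
    let ?B = "{(a, b). a + b = m + ?e \<and> Poly_Mapping.lookup a i \<noteq> 0}"
    let ?F = "\<lambda>(a, b). real (Poly_Mapping.lookup a i) * (mps_nth h a * mps_nth k b)"
    have "mps_nth (mps_deriv i h * k) m = sum ?F ?B"
      unfolding times_mps.rep_eq mps_deriv.rep_eq
    proof (rule sum.reindex_bij_witness[of _ "\<lambda>(a, b). (a - ?e, b)" "\<lambda>(a, b). (a + ?e, b)"])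
      fix x assume x: "x \<in> {(a, b). a + b = m}"
      obtain a b where ab: "x = (a, b)" by (cases x)
      have "a + ?e + b = m + ?e"
        using x by (simp only: ab mem_Collect_eq prod.case add.assoc add.commute[of ?e]) (simp flip: add.assoc)
      then show "(case x of (a, b) \<Rightarrow> (a + ?e, b)) \<in> ?B"
        using lookup_e[of a] by (simp add: ab)
      show "(case case x of (a, b) \<Rightarrow> (a + ?e, b) of (a, b) \<Rightarrow> (a - ?e, b)) = x"
        by (simp add: ab)
      show "?F (case x of (a, b) \<Rightarrow> (a + ?e, b))
        = (case x of (a, b) \<Rightarrow> real (Poly_Mapping.lookup a i + 1) * mps_nth h (a + ?e) * mps_nth k b)"
        by (simp only: ab prod.case lookup_e mult.assoc)
    next
      fix x assume x: "x \<in> ?B"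
      obtain a b where ab: "x = (a, b)" by (cases x)
      show "(case case x of (a, b) \<Rightarrow> (a - ?e, b) of (a, b) \<Rightarrow> (a + ?e, b)) = x"
        using x e[of a] by (simp add: ab)
      show "(case x of (a, b) \<Rightarrow> (a - ?e, b)) \<in> {(a, b). a + b = m}"
        using x sub[of a b] by (simp add: ab)
    qed
    also have "sum ?F ?B = sum ?F ?A"
      by (rule sum.mono_neutral_left) (auto simp: finite_antidiagonal)
    finally show ?thesis ..
  qed
  note left = deriv[of f g]
  have "(\<Sum>(a, b)\<in>?A. real (Poly_Mapping.lookup b i) * (mps_nth f a * mps_nth g b))
      = (\<Sum>(a, b)\<in>?A. real (Poly_Mapping.lookup a i) * (mps_nth g a * mps_nth f b))"
    by (rule sum.reindex_bij_witness[of _ prod.swap prod.swap]) (auto simp: add.commute)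
  then have right: "(\<Sum>(a, b)\<in>?A. real (Poly_Mapping.lookup b i) * (mps_nth f a * mps_nth g b))
      = mps_nth (f * mps_deriv i g) m"
    by (simp only: deriv[of g f] mult.commute[of f])
  have "mps_nth (mps_deriv i (f * g)) m = (\<Sum>(a, b)\<in>?A. real (Poly_Mapping.lookup (m + ?e) i) * (mps_nth f a * mps_nth g b))"
    by (simp add: mps_deriv.rep_eq times_mps.rep_eq sum_distrib_left case_prod_unfold lookup_add)
  also have "\<dots> = (\<Sum>(a, b)\<in>?A. real (Poly_Mapping.lookup a i) * (mps_nth f a * mps_nth g b)
      + real (Poly_Mapping.lookup b i) * (mps_nth f a * mps_nth g b))"
  proof (rule sum.cong[OF refl])
    fix x assume x: "x \<in> ?A"
    obtain a b where ab: "x = (a, b)" by (cases x)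
    have "Poly_Mapping.lookup (m + ?e) i = Poly_Mapping.lookup a i + Poly_Mapping.lookup b i"
      using x by (simp add: ab flip: lookup_add)
    then show "(case x of (a, b) \<Rightarrow> real (Poly_Mapping.lookup (m + ?e) i) * (mps_nth f a * mps_nth g b))
        = (case x of (a, b) \<Rightarrow> real (Poly_Mapping.lookup a i) * (mps_nth f a * mps_nth g b)
          + real (Poly_Mapping.lookup b i) * (mps_nth f a * mps_nth g b))"
      by (simp only: ab prod.case of_nat_add distrib_right)
  qed
  also have "\<dots> = mps_nth (mps_deriv i f * g + f * mps_deriv i g) m"
    by (simp add: plus_mps.rep_eq left[symmetric] right[symmetric] sum.distrib case_prod_unfold)
  finally show "mps_nth (mps_deriv i (f * g)) m = mps_nth (mps_deriv i f * g + f * mps_deriv i g) m" .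
qed

lifting_forget mps.lifting


section \<open>The coefficient field\<close>

text \<open>
  Coefficients live in the field of fractions of the ring of power series. It contains both
  power series and \<open>D\<inverse>\<close> times power series, and, unlike the latter, it is closed under
  products and partial derivatives.
\<close>

type_synonym 'n coeff = "'n mps fract"

definition of_mps :: "'n::{finite,linorder} mps \<Rightarrow> 'n coeff" where
  "of_mps f = Fract f 1"

definition rconst :: "real \<Rightarrow> 'n::{finite,linorder} coeff" where
  "rconst c = of_mps (mps_const c)"

lift_definition coeff_deriv :: "'n::{finite,linorder} \<Rightarrow> 'n coeff \<Rightarrow> 'n coeff"
  is "\<lambda>i (a, b). (mps_deriv i a * b - a * mps_deriv i b, b * b)"
proof -
  fix i :: 'n and x y :: "'n mps \<times> 'n mps"
  assume "fractrel x y"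
  obtain a b c d where xy: "x = (a, b)" "y = (c, d)"
    by (cases x, cases y)
  with \<open>fractrel x y\<close> have nz: "b \<noteq> 0" "d \<noteq> 0" and eq: "a * d = c * b"
    by auto
  have deriv: "mps_deriv i a * d + a * mps_deriv i d = mps_deriv i c * b + c * mps_deriv i b"
    using arg_cong[OF eq, of "mps_deriv i"] by (simp add: mps_deriv_mult)
  have "(mps_deriv i a * b - a * mps_deriv i b) * (d * d)
      - (mps_deriv i c * d - c * mps_deriv i d) * (b * b)
      = b * d * (mps_deriv i a * d + a * mps_deriv i d - (mps_deriv i c * b + c * mps_deriv i b))
        - (a * d - c * b) * (b * mps_deriv i d + d * mps_deriv i b)"
    by (simp add: algebra_simps)
  also have "\<dots> = 0"
    using eq deriv by simp
  finally have *: "(mps_deriv i a * b - a * mps_deriv i b) * (d * d)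
      = (mps_deriv i c * d - c * mps_deriv i d) * (b * b)"
    by (rule eq_iff_diff_eq_0[THEN iffD2])
  have "b * b \<noteq> 0" "d * d \<noteq> 0"
    using nz by simp_all
  with * have "fractrel (mps_deriv i a * b - a * mps_deriv i b, b * b)
      (mps_deriv i c * d - c * mps_deriv i d, d * d)"
    unfolding fractrel_iff fst_conv snd_conv by blast
  then show "fractrel (case x of (a, b) \<Rightarrow> (mps_deriv i a * b - a * mps_deriv i b, b * b))
      (case y of (a, b) \<Rightarrow> (mps_deriv i a * b - a * mps_deriv i b, b * b))"
    unfolding xy prod.case .
qed

lemma coeff_deriv_Fract:
  "b \<noteq> 0 \<Longrightarrow> coeff_deriv i (Fract a b) = Fract (mps_deriv i a * b - a * mps_deriv i b) (b * b)"
  by transfer simp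

lemma mps_deriv_1: "mps_deriv i (1 :: 'n::{finite,linorder} mps) = 0"
proof -
  have "mps_deriv i (1 :: 'n mps) = mps_deriv i 1 + mps_deriv i 1"
    using mps_deriv_mult[of i 1 "1 :: 'n mps"] by (simp only: mult_1_left mult_1_right)
  then show ?thesis
    by (simp only: add_cancel_right_right)
qed

lemma coeff_deriv_of_mps: "coeff_deriv i (of_mps f) = of_mps (mps_deriv i f)"
  by (simp add: of_mps_def coeff_deriv_Fract mps_deriv_1)

lemma coeff_deriv_add: "coeff_deriv i (f + g) = coeff_deriv i f + coeff_deriv i g"
proof (cases f, cases g)
  fix a b c d
  assume fg: "f = Fract a b" "g = Fract c d" and nz: "b \<noteq> 0" "d \<noteq> 0"
  show ?thesis
    unfolding fg using nz
    by (simp add: coeff_deriv_Fract)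
      (rule arg_cong2[of _ _ _ _ Fract]; simp add: mps_deriv_mult mps_deriv_add algebra_simps)
qed

lemma coeff_deriv_mult: "coeff_deriv i (f * g) = coeff_deriv i f * g + f * coeff_deriv i g"
proof (cases f, cases g)
  fix a b c d
  assume fg: "f = Fract a b" "g = Fract c d" and nz: "b \<noteq> 0" "d \<noteq> 0"
  let ?b = "mps_deriv i b" and ?d = "mps_deriv i d"
  have "coeff_deriv i (f * g)
      = Fract (mps_deriv i (a * c) * (b * d) - a * c * mps_deriv i (b * d)) (b * d * (b * d))"
    unfolding fg using nz by (simp add: coeff_deriv_Fract)
  also have "\<dots> = Fract ((b * d) * (mps_deriv i (a * c) * (b * d) - a * c * mps_deriv i (b * d)))
      ((b * d) * (b * d * (b * d)))"
    using nz by (simp add: mult_fract_cancel)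
  also have "\<dots> = coeff_deriv i f * g + f * coeff_deriv i g"
    unfolding fg using nz
    by (simp add: coeff_deriv_Fract)
      (rule arg_cong2[of _ _ _ _ Fract]; simp add: mps_deriv_mult mps_deriv_add algebra_simps)
  finally show ?thesis .
qed

lemma coeff_deriv_0 [simp]: "coeff_deriv i 0 = 0"
  using coeff_deriv_add[of i 0 0] by (simp only: add_0_right add_cancel_right_right)

lemma coeff_deriv_1 [simp]: "coeff_deriv i 1 = 0"
  using coeff_deriv_mult[of i 1 1] by (simp only: mult_1_left mult_1_right add_cancel_right_right)

lemma coeff_deriv_uminus: "coeff_deriv i (- f) = - coeff_deriv i f"
  by (rule add_eq_0_iff[THEN iffD1]) (simp flip: coeff_deriv_add)

lemma rconst_add: "rconst (a + b) = rconst a + rconst b"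
  by (simp add: rconst_def of_mps_def mps_const_add)

lemma rconst_mult: "rconst (a * b) = rconst a * rconst b"
  by (simp add: rconst_def of_mps_def mps_const_mult)

lemma rconst_1 [simp]: "rconst 1 = 1"
  by (simp add: rconst_def of_mps_def mps_const_1 One_fract_def)


section \<open>Vector fields and polyvectors\<close>

text \<open>The \<open>r\<close>-th component of a vector field is its coefficient at the \<open>r\<close>-th partial derivative.\<close>

type_synonym 'n vfield = "'n mps fract ^ 'n"

definition vf_apply :: "'n::{finite,linorder} vfield \<Rightarrow> 'n coeff \<Rightarrow> 'n coeff" where
  "vf_apply X f = (\<Sum>r\<in>UNIV. X $ r * coeff_deriv r f)"

definition lie_bracket :: "'n::{finite,linorder} vfield \<Rightarrow> 'n vfield \<Rightarrow> 'n vfield" where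
  "lie_bracket X Z = (\<chi> s. vf_apply X (Z $ s) - vf_apply Z (X $ s))"

definition divergence :: "'n::{finite,linorder} vfield \<Rightarrow> 'n coeff" where
  "divergence X = (\<Sum>r\<in>UNIV. coeff_deriv r (X $ r))"

text \<open>The component of a polyvector at the index set \<open>{i\<^sub>1 < \<dots> < i\<^sub>p}\<close> is its coefficient at
  \<open>\<partial>\<^sub>i\<^sub>1 \<and> \<dots> \<and> \<partial>\<^sub>i\<^sub>p\<close>.\<close>

type_synonym 'n pvec = "'n mps fract ^ ('n set)"

definition pv_fun :: "'n::{finite,linorder} coeff \<Rightarrow> 'n pvec" where
  "pv_fun f = axis {} f"

definition pv_vec :: "'n::{finite,linorder} vfield \<Rightarrow> 'n pvec" where
  "pv_vec X = (\<Sum>r\<in>UNIV. axis {r} (X $ r))"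

definition pv_deg :: "nat \<Rightarrow> 'n::{finite,linorder} pvec set" where
  "pv_deg p = {A. \<forall>I. A $ I \<noteq> 0 \<longrightarrow> card I = p}"

text \<open>For disjoint \<open>I\<close> and \<open>J\<close>, the sign of the permutation that sorts the increasing
  enumeration of \<open>I\<close> followed by that of \<open>J\<close>.\<close>

definition shuffle_sign :: "'n::{finite,linorder} set \<Rightarrow> 'n set \<Rightarrow> 'n coeff" where
  "shuffle_sign I J = (if I \<inter> J = {} then (-1) ^ card {(i, j). i \<in> I \<and> j \<in> J \<and> j < i} else 0)"

definition wedge :: "'n::{finite,linorder} pvec \<Rightarrow> 'n pvec \<Rightarrow> 'n pvec"  (infixr \<open>\<and>\<^sub>W\<close> 70) where
  "A \<and>\<^sub>W B = (\<chi> K. \<Sum>I\<in>Pow K. shuffle_sign I (K - I) * A $ I * B $ (K - I))"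

text \<open>\<open>wedge_family Y {k\<^sub>1 < \<dots> < k\<^sub>p} = Y k\<^sub>1 \<and> \<dots> \<and> Y k\<^sub>p\<close>\<close>

definition wedge_family :: "('n::{finite,linorder} \<Rightarrow> 'n vfield) \<Rightarrow> 'n set \<Rightarrow> 'n pvec" where
  "wedge_family Y k = foldr (\<lambda>i A. pv_vec (Y i) \<and>\<^sub>W A) (sorted_list_of_set k) (pv_fun 1)"


section \<open>The Schouten-Nijenhuis bracket\<close>

definition pv_deriv :: "'n::{finite,linorder} \<Rightarrow> 'n pvec \<Rightarrow> 'n pvec" where
  "pv_deriv i A = (\<chi> I. coeff_deriv i (A $ I))"

text \<open>The left and right derivatives with respect to the odd variable \<open>\<partial>\<^sub>i\<close>.\<close>

definition contract_left :: "'n::{finite,linorder} \<Rightarrow> 'n pvec \<Rightarrow> 'n pvec" where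
  "contract_left i A = (\<chi> J. shuffle_sign {i} J * A $ insert i J)"

definition contract_right :: "'n::{finite,linorder} \<Rightarrow> 'n pvec \<Rightarrow> 'n pvec" where
  "contract_right i A = (\<chi> J. shuffle_sign J {i} * A $ insert i J)"

definition sn_bracket :: "'n::{finite,linorder} pvec \<Rightarrow> 'n pvec \<Rightarrow> 'n pvec" where
  "sn_bracket P Q = (\<Sum>i\<in>UNIV. contract_right i P \<and>\<^sub>W pv_deriv i Q - pv_deriv i P \<and>\<^sub>W contract_left i Q)"

text \<open>
  The conventions that characterise the bracket; theorem \<open>schouten_nijenhuis_iff\<close> below shows that
  they hold for \<^const>\<open>sn_bracket\<close> and for no other operation. In the exponents, \<open>p + 1\<close> replaces
  the \<open>p - 1\<close> of the usual sign rules, which has the same parity and needs no truncated subtraction.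
\<close>

definition schouten_nijenhuis :: "('n::{finite,linorder} pvec \<Rightarrow> 'n pvec \<Rightarrow> 'n pvec) \<Rightarrow> bool" where
  "schouten_nijenhuis B \<longleftrightarrow>
    (\<forall>P P' Q. B (P + P') Q = B P Q + B P' Q) \<and>
    (\<forall>P Q Q'. B P (Q + Q') = B P Q + B P Q') \<and>
    (\<forall>f g. B (pv_fun f) (pv_fun g) = 0) \<and>
    (\<forall>X f. B (pv_vec X) (pv_fun f) = pv_fun (vf_apply X f)) \<and>
    (\<forall>X Z. B (pv_vec X) (pv_vec Z) = pv_vec (lie_bracket X Z)) \<and>
    (\<forall>p q. \<forall>P\<in>pv_deg p. \<forall>Q\<in>pv_deg q. B P Q = - ((-1) ^ ((p + 1) * (q + 1)) *s B Q P)) \<and>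
    (\<forall>p q. \<forall>P\<in>pv_deg p. \<forall>Q\<in>pv_deg q. \<forall>R.
      B P (Q \<and>\<^sub>W R) = B P Q \<and>\<^sub>W R + (-1) ^ ((p + 1) * q) *s (Q \<and>\<^sub>W B P R))"

lemma axis_scale: "axis I (c * a) = c *s (axis I a :: 'a::field ^ 'k)"
  by (simp add: vec_eq_iff axis_def)

lemma axis_add: "axis I (a + b) = axis I a + (axis I b :: 'a::field ^ 'k)"
  by (simp add: vec_eq_iff axis_def)

lemma axis_uminus: "axis I (- a) = - (axis I a :: 'a::field ^ 'k)"
  by (simp add: vec_eq_iff axis_def)

lemma axis_0 [simp]: "axis I 0 = (0 :: 'a::field ^ 'k)"
  by (simp add: vec_eq_iff axis_def)

lemma pvec_expand: "A = (\<Sum>I\<in>UNIV. axis I (A $ I :: 'a::field))"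
  by (simp add: vec_eq_iff axis_def if_distrib cong: if_cong)

lemma pvec_induct [case_names add axis]:
  fixes A :: "'a::field ^ 'k"
  assumes "\<And>A B. P A \<Longrightarrow> P B \<Longrightarrow> P (A + B)" and "\<And>I a. P (axis I a)"
  shows "P A"
proof -
  have "finite S \<Longrightarrow> P (\<Sum>I\<in>S. axis I (A $ I))" for S
  proof (induction S rule: finite_induct)
    case empty
    then show ?case using assms(2)[of undefined 0] by simp
  next
    case (insert I S)
    then show ?case using assms by simp
  qed
  then show ?thesis
    by (subst pvec_expand) simp
qed

lemma wedge_add_left: "(A + A') \<and>\<^sub>W B = A \<and>\<^sub>W B + A' \<and>\<^sub>W B"
  by (simp add: wedge_def vec_eq_iff algebra_simps sum.distrib)

lemma wedge_add_right: "A \<and>\<^sub>W (B + B') = A \<and>\<^sub>W B + A \<and>\<^sub>W B'"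
  by (simp add: wedge_def vec_eq_iff algebra_simps sum.distrib)

lemma wedge_scale_left: "(c *s A) \<and>\<^sub>W B = c *s (A \<and>\<^sub>W B)"
  by (simp add: wedge_def vec_eq_iff sum_distrib_left ac_simps)

lemma wedge_scale_right: "A \<and>\<^sub>W (c *s B) = c *s (A \<and>\<^sub>W B)"
  by (simp add: wedge_def vec_eq_iff sum_distrib_left ac_simps)

lemma wedge_0 [simp]: "0 \<and>\<^sub>W B = 0" "A \<and>\<^sub>W 0 = 0"
  by (simp_all add: wedge_def vec_eq_iff)

lemma wedge_diff_left: "(A - A') \<and>\<^sub>W B = A \<and>\<^sub>W B - A' \<and>\<^sub>W B"
  using wedge_add_left[of "A - A'" A' B] by simp

lemma wedge_uminus_left: "(- A) \<and>\<^sub>W B = - (A \<and>\<^sub>W B)"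
  using wedge_diff_left[of 0 A B] by simp

lemma wedge_diff_right: "A \<and>\<^sub>W (B - B') = A \<and>\<^sub>W B - A \<and>\<^sub>W B'"
  using wedge_add_right[of A "B - B'" B'] by simp

lemma wedge_sum_left: "(\<Sum>i\<in>S. f i) \<and>\<^sub>W B = (\<Sum>i\<in>S. f i \<and>\<^sub>W B)"
  by (induction S rule: infinite_finite_induct) (auto simp: wedge_add_left)

lemma wedge_sum_right: "A \<and>\<^sub>W (\<Sum>i\<in>S. f i) = (\<Sum>i\<in>S. A \<and>\<^sub>W f i)"
  by (induction S rule: infinite_finite_induct) (auto simp: wedge_add_right)

lemma wedge_axis: "axis I a \<and>\<^sub>W axis J b = axis (I \<union> J) (shuffle_sign I J * a * b)"
proof -
  have "(\<Sum>L\<in>Pow K. shuffle_sign L (K - L) * axis I a $ L * axis J b $ (K - L))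
      = (if K = I \<union> J then shuffle_sign I J * a * b else 0)" for K
  proof (cases "I \<subseteq> K \<and> K - I = J")
    case True
    then have *: "K = I \<union> J" by auto
    have "(\<Sum>L\<in>Pow K. shuffle_sign L (K - L) * axis I a $ L * axis J b $ (K - L))
        = (\<Sum>L\<in>Pow K. if L = I then shuffle_sign I J * a * b else 0)"
      by (rule sum.cong) (use True in \<open>auto simp: axis_def\<close>)
    also have "\<dots> = shuffle_sign I J * a * b"
      using * by simp
    finally show ?thesis
      using * by simp
  next
    case False
    have "(\<Sum>L\<in>Pow K. shuffle_sign L (K - L) * axis I a $ L * axis J b $ (K - L)) = 0"
      by (rule sum.neutral) (use False in \<open>auto simp: axis_def\<close>)
    moreover have "shuffle_sign I J = 0" if "K = I \<union> J"
      using False that by (auto simp: shuffle_sign_def)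
    ultimately show ?thesis
      by simp
  qed
  then show ?thesis
    by (simp add: wedge_def vec_eq_iff axis_def eq_commute)
qed

lemma finite_pairs: "finite {(i :: 'n::finite, j :: 'n). P i j}"
  by (rule finite_subset[OF subset_UNIV]) simp

lemma shuffle_sign_Un_left:
  assumes "I \<inter> J = {}"
  shows "shuffle_sign (I \<union> J) M = shuffle_sign I M * shuffle_sign J M"
proof -
  have "{(i, j). i \<in> I \<union> J \<and> j \<in> M \<and> j < i}
      = {(i, j). i \<in> I \<and> j \<in> M \<and> j < i} \<union> {(i, j). i \<in> J \<and> j \<in> M \<and> j < i}"
    by auto
  moreover have "card \<dots> = card {(i, j). i \<in> I \<and> j \<in> M \<and> j < i} + card {(i, j). i \<in> J \<and> j \<in> M \<and> j < i}"
    by (rule card_Un_disjoint) (use assms in \<open>auto simp: finite_pairs\<close>)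
  ultimately show ?thesis
    by (auto simp: shuffle_sign_def power_add)
qed

lemma shuffle_sign_Un_right:
  assumes "J \<inter> M = {}"
  shows "shuffle_sign I (J \<union> M) = shuffle_sign I J * shuffle_sign I M"
proof -
  have "{(i, j). i \<in> I \<and> j \<in> J \<union> M \<and> j < i}
      = {(i, j). i \<in> I \<and> j \<in> J \<and> j < i} \<union> {(i, j). i \<in> I \<and> j \<in> M \<and> j < i}"
    by auto
  moreover have "card \<dots> = card {(i, j). i \<in> I \<and> j \<in> J \<and> j < i} + card {(i, j). i \<in> I \<and> j \<in> M \<and> j < i}"
    by (rule card_Un_disjoint) (use assms in \<open>auto simp: finite_pairs\<close>)
  ultimately show ?thesis
    by (auto simp: shuffle_sign_def power_add)
qed

lemma shuffle_sign_assoc: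
  "shuffle_sign I J * shuffle_sign (I \<union> J) M = shuffle_sign J M * shuffle_sign I (J \<union> M)"
proof (cases "I \<inter> J = {} \<and> J \<inter> M = {}")
  case True
  then show ?thesis
    by (simp add: shuffle_sign_Un_left shuffle_sign_Un_right)
next
  case False
  then show ?thesis
    by (auto simp: shuffle_sign_def)
qed

lemma shuffle_sign_commute: "shuffle_sign I J = (-1) ^ (card I * card J) * shuffle_sign J I"
proof (cases "I \<inter> J = {}")
  case True
  let ?A = "{(i, j). i \<in> I \<and> j \<in> J \<and> j < i}" and ?B = "{(j, i). j \<in> J \<and> i \<in> I \<and> i < j}"
  have IJ: "I \<times> J = ?A \<union> prod.swap ` ?B"
    using True by (auto simp: image_iff)
  have "card (?A \<union> prod.swap ` ?B) = card ?A + card (prod.swap ` ?B)"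
    by (rule card_Un_disjoint) (auto simp: finite_pairs)
  moreover have "card (prod.swap ` ?B) = card ?B"
    by (rule card_image) simp
  ultimately have "card I * card J = card ?A + card ?B"
    unfolding card_cartesian_product[symmetric] IJ by simp
  then have "(-1 :: 'a coeff) ^ (card I * card J) * (-1) ^ card ?B = (-1) ^ card ?A"
    by (simp add: power_add)
  moreover have "J \<inter> I = {}"
    using True by blast
  ultimately show ?thesis
    using True by (simp add: shuffle_sign_def)
qed (auto simp: shuffle_sign_def)

lemma shuffle_sign_square: "I \<inter> J = {} \<Longrightarrow> shuffle_sign I J * shuffle_sign I J = 1"
  by (simp add: shuffle_sign_def flip: power_add)

lemma shuffle_sign_empty [simp]: "shuffle_sign {} J = 1" "shuffle_sign I {} = 1"
  by (simp_all add: shuffle_sign_def)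

lemma wedge_assoc: "(A \<and>\<^sub>W B) \<and>\<^sub>W C = A \<and>\<^sub>W B \<and>\<^sub>W C"
proof (induction A rule: pvec_induct)
  case (axis I a)
  show ?case
  proof (induction B rule: pvec_induct)
    case (axis J b)
    show ?case
    proof (induction C rule: pvec_induct)
      case (axis M c)
      show ?case
        using shuffle_sign_assoc[of I J M] by (simp add: wedge_axis Un_assoc algebra_simps)
    qed (simp add: wedge_add_right)
  qed (simp add: wedge_add_left wedge_add_right)
qed (simp add: wedge_add_left)

lemma pv_deg_induct [consumes 1, case_names zero add axis]:
  assumes "A \<in> pv_deg p" and "P 0" and "\<And>A B. P A \<Longrightarrow> P B \<Longrightarrow> P (A + B)"
    and "\<And>I a. card I = p \<Longrightarrow> P (axis I a)"
  shows "P A"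
proof -
  have "finite S \<Longrightarrow> P (\<Sum>I\<in>S. axis I (A $ I))" for S
  proof (induction S rule: finite_induct)
    case empty
    then show ?case using assms(2) by simp
  next
    case (insert I S)
    have "P (axis I (A $ I))"
      using assms(1,2,4) by (cases "A $ I = 0") (auto simp: pv_deg_def)
    with insert show ?case using assms by simp
  qed
  then show ?thesis
    by (subst pvec_expand) simp
qed

lemma pv_deg_0 [simp]: "0 \<in> pv_deg p"
  by (simp add: pv_deg_def)

lemma pv_deg_add: "A \<in> pv_deg p \<Longrightarrow> B \<in> pv_deg p \<Longrightarrow> A + B \<in> pv_deg p"
  by (auto simp: pv_deg_def) (metis add_0)

lemma pv_deg_axis: "card I = p \<Longrightarrow> axis I a \<in> pv_deg p"
  by (auto simp: pv_deg_def axis_def)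

lemma wedge_commute:
  assumes "A \<in> pv_deg p" and "B \<in> pv_deg q"
  shows "A \<and>\<^sub>W B = (-1) ^ (p * q) *s (B \<and>\<^sub>W A)"
  using assms(1)
proof (induction A rule: pv_deg_induct)
  case (axis I a)
  from assms(2) show ?case
  proof (induction B rule: pv_deg_induct)
    case (axis J b)
    have "shuffle_sign I J = (-1) ^ (p * q) * shuffle_sign J I"
      using shuffle_sign_commute[of I J] axis \<open>card I = p\<close> by simp
    then have "axis I a \<and>\<^sub>W axis J b = axis (J \<union> I) ((-1) ^ (p * q) * (shuffle_sign J I * b * a))"
      unfolding wedge_axis by (simp only: Un_commute mult.assoc mult.commute[of a])
    then show ?case
      by (simp only: axis_scale wedge_axis)
  qed (simp_all only: wedge_add_left wedge_add_right vec.scale_right_distrib wedge_0 vec.scale_zero_right)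
qed (simp_all only: wedge_add_left wedge_add_right vec.scale_right_distrib wedge_0 vec.scale_zero_right)

lemma pv_deriv_add: "pv_deriv i (A + B) = pv_deriv i A + pv_deriv i B"
  by (simp add: pv_deriv_def vec_eq_iff coeff_deriv_add)

lemma pv_deriv_axis: "pv_deriv i (axis I a) = axis I (coeff_deriv i a)"
  by (simp add: pv_deriv_def vec_eq_iff axis_def)

lemma pv_deriv_0 [simp]: "pv_deriv i 0 = 0"
  by (simp add: pv_deriv_def vec_eq_iff)

lemma pv_deg_pv_deriv: "A \<in> pv_deg p \<Longrightarrow> pv_deriv i A \<in> pv_deg p"
  by (simp add: pv_deg_def pv_deriv_def) (metis coeff_deriv_0)

lemma coeff_deriv_shuffle_sign [simp]: "coeff_deriv i (shuffle_sign I J) = 0"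
proof -
  have "coeff_deriv i ((-1) ^ n) = 0" for n
    by (induction n) (auto simp: coeff_deriv_mult coeff_deriv_uminus)
  then show ?thesis
    by (simp add: shuffle_sign_def)
qed

lemma pv_deriv_wedge: "pv_deriv i (A \<and>\<^sub>W B) = pv_deriv i A \<and>\<^sub>W B + A \<and>\<^sub>W pv_deriv i B"
proof (induction A rule: pvec_induct)
  case (axis I a)
  show ?case
  proof (induction B rule: pvec_induct)
    case (axis J b)
    show ?case
      by (simp add: wedge_axis pv_deriv_axis coeff_deriv_mult algebra_simps flip: axis_add)
  qed (simp add: wedge_add_right pv_deriv_add)
qed (simp add: wedge_add_left pv_deriv_add)

lemma contract_left_add: "contract_left i (A + B) = contract_left i A + contract_left i B"
  by (simp add: contract_left_def vec_eq_iff distrib_left)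

lemma contract_right_add: "contract_right i (A + B) = contract_right i A + contract_right i B"
  by (simp add: contract_right_def vec_eq_iff distrib_left)

lemma contract_0 [simp]: "contract_left i 0 = 0" "contract_right i 0 = 0"
  by (simp_all add: contract_left_def contract_right_def vec_eq_iff)

lemma contract_left_axis:
  "contract_left i (axis I a) = (if i \<in> I then axis (I - {i}) (shuffle_sign {i} (I - {i}) * a) else 0)"
  by (auto simp: contract_left_def vec_eq_iff axis_def shuffle_sign_def)

lemma contract_right_axis:
  "contract_right i (axis I a) = (if i \<in> I then axis (I - {i}) (shuffle_sign (I - {i}) {i} * a) else 0)"
  by (auto simp: contract_right_def vec_eq_iff axis_def shuffle_sign_def)

lemma pv_deg_contract_left: "A \<in> pv_deg (Suc p) \<Longrightarrow> contract_left i A \<in> pv_deg p"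
  by (induction A rule: pv_deg_induct)
    (auto simp: contract_left_add contract_left_axis intro: pv_deg_add pv_deg_axis)

lemma contract_left_deg_0: "A \<in> pv_deg 0 \<Longrightarrow> contract_left i A = 0"
  by (induction A rule: pv_deg_induct) (auto simp: contract_left_add contract_left_axis)

lemma contract_right_eq:
  assumes "A \<in> pv_deg p"
  shows "contract_right i A = (-1) ^ (p + 1) *s contract_left i A"
  using assms
proof (induction A rule: pv_deg_induct)
  case (axis I a)
  show ?case
  proof (cases "i \<in> I")
    case True
    then obtain k where k: "card (I - {i}) = k" "p = Suc k"
      using axis by (metis card_Suc_Diff1 finite)
    then show ?thesis
      using True by (simp add: contract_left_axis contract_right_axis
        shuffle_sign_commute[of "I - {i}" "{i}"] mult.assoc flip: axis_scale)
  qed (simp add: contract_left_axis contract_right_axis)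
qed (auto simp: contract_left_add contract_right_add vector_add_ldistrib)

lemma contract_left_wedge:
  assumes "A \<in> pv_deg q"
  shows "contract_left i (A \<and>\<^sub>W B) = contract_left i A \<and>\<^sub>W B + (-1) ^ q *s (A \<and>\<^sub>W contract_left i B)"
  using assms
proof (induction A rule: pv_deg_induct)
  case (axis I a)
  show ?case
  proof (induction B rule: pvec_induct)
    case (axis J b)
    define I' where "I' = I - {i}"
    define J' where "J' = J - {i}"
    let ?s = "shuffle_sign :: 'a set \<Rightarrow> 'a set \<Rightarrow> 'a coeff"
    note defs = wedge_axis contract_left_axis
    consider "i \<notin> I" "i \<notin> J" | "i \<in> I" "i \<notin> J" | "i \<notin> I" "i \<in> J" | "i \<in> I" "i \<in> J"
      by blast
    then show ?case
    proof cases
      case 1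
      then show ?thesis by (simp add: defs)
    next
      case 2
      then have I: "I = {i} \<union> I'" "i \<notin> I'" and U: "I \<union> J - {i} = I' \<union> J"
        by (auto simp: I'_def)
      have "?s {i} I' * ?s I J = ?s I' J * ?s {i} (I' \<union> J)"
        using shuffle_sign_assoc[of "{i}" I' J] I by simp
      moreover have "?s {i} I' * ?s {i} I' = 1" "?s {i} (I' \<union> J) * ?s {i} (I' \<union> J) = 1"
        using I 2 by (auto intro!: shuffle_sign_square)
      ultimately have "?s I J * ?s {i} (I' \<union> J) = ?s {i} I' * ?s I' J"
        by algebra
      then show ?thesis
        using 2 U by (simp add: defs algebra_simps flip: I'_def)
    next
      case 3
      then have J: "J = {i} \<union> J'" "i \<notin> J'" and U: "I \<union> J - {i} = I \<union> J'"
        by (auto simp: J'_def)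
      have A: "?s I {i} * ?s (insert i I) J' = ?s {i} J' * ?s I J"
        using shuffle_sign_assoc[of I "{i}" J'] J by simp
      have B: "?s {i} I * ?s (insert i I) J' = ?s I J' * ?s {i} (I \<union> J')"
        using shuffle_sign_assoc[of "{i}" I J'] by simp
      have C: "?s I {i} = (-1) ^ q * ?s {i} I"
        using shuffle_sign_commute[of I "{i}"] axis \<open>card I = q\<close> by simp
      have sq: "?s {i} J' * ?s {i} J' = 1" "?s {i} (I \<union> J') * ?s {i} (I \<union> J') = 1"
        using J 3 by (auto intro!: shuffle_sign_square)
      have "?s {i} J' * ?s I J = (-1) ^ q * (?s I J' * ?s {i} (I \<union> J'))"
        using A unfolding C by (simp only: mult.assoc B)
      then have "?s {i} J' * (?s {i} J' * ?s I J) * ?s {i} (I \<union> J')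
          = ?s {i} J' * ((-1) ^ q * (?s I J' * ?s {i} (I \<union> J'))) * ?s {i} (I \<union> J')"
        by simp
      then have "(?s {i} J' * ?s {i} J') * (?s I J * ?s {i} (I \<union> J'))
          = (?s {i} (I \<union> J') * ?s {i} (I \<union> J')) * ((-1) ^ q * (?s {i} J' * ?s I J'))"
        by (simp only: ac_simps)
      then have "?s I J * ?s {i} (I \<union> J') = (-1) ^ q * (?s {i} J' * ?s I J')"
        unfolding sq by simp
      then show ?thesis
        using 3 U by (simp add: defs algebra_simps flip: J'_def axis_scale)
    next
      case 4
      then have I: "I = {i} \<union> I'" "i \<notin> I'" and J: "J = {i} \<union> J'" "i \<notin> J'"
        and U: "I' \<union> J = I \<union> J'"
        by (auto simp: I'_def J'_def)
      have zero: "?s I J = 0"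
        using 4 by (auto simp: shuffle_sign_def)
      have q: "q = Suc (card I')"
        using \<open>card I = q\<close> I by simp
      have A: "?s I' {i} * ?s I J' = ?s {i} J' * ?s I' J"
        using shuffle_sign_assoc[of I' "{i}" J'] I J by simp
      have B: "?s I' {i} = (-1) ^ card I' * ?s {i} I'"
        using shuffle_sign_commute[of I' "{i}"] by simp
      have sq: "?s {i} I' * ?s {i} I' = 1" "?s {i} J' * ?s {i} J' = 1"
        using I J by (auto intro!: shuffle_sign_square)
      have "?s {i} I' * (?s {i} J' * ?s I' J) * ?s {i} J'
          = ?s {i} I' * ((-1) ^ card I' * ?s {i} I' * ?s I J') * ?s {i} J'"
        using A unfolding B by simp
      then have "(?s {i} J' * ?s {i} J') * (?s {i} I' * ?s I' J)
          = (?s {i} I' * ?s {i} I') * ((-1) ^ card I' * (?s {i} J' * ?s I J'))"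
        by (simp only: ac_simps)
      then have *: "?s {i} I' * ?s I' J = - ((-1) ^ q * (?s {i} J' * ?s I J'))"
        unfolding sq q by simp
      have "contract_left i (axis I a) \<and>\<^sub>W axis J b = axis (I \<union> J') (?s {i} I' * ?s I' J * (a * b))"
        using 4 U by (simp add: defs algebra_simps flip: I'_def)
      also have "\<dots> = - ((-1) ^ q *s (axis I a \<and>\<^sub>W contract_left i (axis J b)))"
        unfolding * using 4 by (simp add: defs algebra_simps flip: J'_def axis_scale axis_uminus)
      finally show ?thesis
        using zero by (simp add: wedge_axis)
    qed
  qed (simp add: wedge_add_right contract_left_add vector_add_ldistrib)
qed (auto simp: wedge_add_left contract_left_add vector_add_ldistrib)

lemma sn_bracket_add_left: "sn_bracket (P + P') Q = sn_bracket P Q + sn_bracket P' Q"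
  unfolding sn_bracket_def contract_right_add pv_deriv_add wedge_add_left
  by (simp add: sum.distrib[symmetric] algebra_simps)

lemma sn_bracket_add_right: "sn_bracket P (Q + Q') = sn_bracket P Q + sn_bracket P Q'"
  unfolding sn_bracket_def contract_left_add pv_deriv_add wedge_add_right
  by (simp add: sum.distrib[symmetric] algebra_simps)

lemma pv_deg_fun: "pv_fun f \<in> pv_deg 0"
  by (simp add: pv_fun_def pv_deg_axis)

lemma pv_deg_sum: "(\<And>i. i \<in> S \<Longrightarrow> f i \<in> pv_deg p) \<Longrightarrow> (\<Sum>i\<in>S. f i) \<in> pv_deg p"
  by (induction S rule: infinite_finite_induct) (auto intro: pv_deg_add)

lemma pv_deg_vec: "pv_vec X \<in> pv_deg 1"
  unfolding pv_vec_def by (rule pv_deg_sum) (simp add: pv_deg_axis)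

lemma contract_fun [simp]: "contract_left i (pv_fun f) = 0" "contract_right i (pv_fun f) = 0"
  by (simp_all add: pv_fun_def contract_left_axis contract_right_axis)

lemma contract_left_sum: "contract_left i (\<Sum>r\<in>S. f r) = (\<Sum>r\<in>S. contract_left i (f r))"
  by (induction S rule: infinite_finite_induct) (auto simp: contract_left_add)

lemma pv_deriv_sum: "pv_deriv i (\<Sum>r\<in>S. f r) = (\<Sum>r\<in>S. pv_deriv i (f r))"
  by (induction S rule: infinite_finite_induct) (auto simp: pv_deriv_add)

lemma contract_left_vec: "contract_left i (pv_vec X) = pv_fun (X $ i)"
proof -
  have "contract_left i (pv_vec X) = (\<Sum>r\<in>UNIV. if r = i then pv_fun (X $ i) else 0)"
    unfolding pv_vec_def contract_left_sum
    by (rule sum.cong) (auto simp: contract_left_axis pv_fun_def)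
  then show ?thesis by simp
qed

lemma contract_right_vec: "contract_right i (pv_vec X) = pv_fun (X $ i)"
  by (simp add: contract_right_eq[OF pv_deg_vec] contract_left_vec)

lemma pv_deriv_fun: "pv_deriv i (pv_fun f) = pv_fun (coeff_deriv i f)"
  by (simp add: pv_fun_def pv_deriv_axis)

lemma pv_deriv_vec: "pv_deriv i (pv_vec X) = pv_vec (\<chi> r. coeff_deriv i (X $ r))"
  by (simp add: pv_vec_def pv_deriv_sum pv_deriv_axis)

lemma wedge_fun_left: "pv_fun f \<and>\<^sub>W A = f *s A"
proof (induction A rule: pvec_induct)
  case (axis I a)
  then show ?case by (simp add: pv_fun_def wedge_axis axis_scale)
qed (simp add: wedge_add_right vector_add_ldistrib)

lemma wedge_fun_right: "A \<and>\<^sub>W pv_fun f = f *s A"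
proof (induction A rule: pvec_induct)
  case (axis I a)
  then show ?case by (simp add: pv_fun_def wedge_axis mult.commute flip: axis_scale)
qed (simp add: wedge_add_left vector_add_ldistrib)

lemma pv_fun_add: "pv_fun (f + g) = pv_fun f + pv_fun g"
  by (simp add: pv_fun_def axis_add)

lemma pv_fun_sum: "pv_fun (\<Sum>r\<in>S. f r) = (\<Sum>r\<in>S. pv_fun (f r))"
  by (induction S rule: infinite_finite_induct) (auto simp: pv_fun_add, auto simp: pv_fun_def)

lemma scale_pv_fun: "c *s pv_fun f = pv_fun (c * f)"
  by (simp add: pv_fun_def axis_scale)

lemma pv_vec_add: "pv_vec (X + Z) = pv_vec X + pv_vec Z"
  by (simp add: pv_vec_def axis_add sum.distrib)

lemma pv_vec_0 [simp]: "pv_vec 0 = 0"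
  by (simp add: pv_vec_def)

lemma pv_vec_diff: "pv_vec (X - Z) = pv_vec X - pv_vec Z"
  using pv_vec_add[of "X - Z" Z] by simp

lemma pv_vec_sum: "pv_vec (\<Sum>r\<in>S. X r) = (\<Sum>r\<in>S. pv_vec (X r))"
  by (induction S rule: infinite_finite_induct) (auto simp: pv_vec_add)

lemma pv_vec_scale: "pv_vec (c *s X) = c *s pv_vec X"
  by (simp add: pv_vec_def axis_scale vec.scale_sum_right)

lemma pv_vec_axis: "pv_vec (axis i a) = axis {i} a"
proof -
  have "pv_vec (axis i a) = (\<Sum>r\<in>UNIV. if r = i then axis {i} a else 0)"
    unfolding pv_vec_def by (rule sum.cong) (auto simp: axis_def[of i])
  then show ?thesis by simp
qed

lemma sn_bracket_fun_fun: "sn_bracket (pv_fun f) (pv_fun g) = 0"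
  by (simp add: sn_bracket_def)

lemma sn_bracket_vec_fun: "sn_bracket (pv_vec X) (pv_fun f) = pv_fun (vf_apply X f)"
  by (simp add: sn_bracket_def contract_right_vec pv_deriv_fun wedge_fun_left scale_pv_fun
      vf_apply_def pv_fun_sum)

lemma sn_bracket_vec_vec: "sn_bracket (pv_vec X) (pv_vec Z) = pv_vec (lie_bracket X Z)"
proof -
  have lie: "lie_bracket X Z = (\<Sum>i\<in>UNIV. (X $ i *s (\<chi> r. coeff_deriv i (Z $ r)))
      - (Z $ i *s (\<chi> r. coeff_deriv i (X $ r))))"
    by (simp add: vec_eq_iff lie_bracket_def vf_apply_def sum_subtractf)
  show ?thesis
    unfolding lie pv_vec_sum pv_vec_diff pv_vec_scale
    by (simp add: sn_bracket_def contract_right_vec contract_left_vec pv_deriv_vec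
        wedge_fun_left wedge_fun_right)
qed

lemma pv_deg_contract_left': "A \<in> pv_deg p \<Longrightarrow> contract_left i A \<in> pv_deg (p - 1)"
  by (cases p) (auto simp: contract_left_deg_0 intro: pv_deg_contract_left)

lemma wedge_commute_contract:
  assumes "A \<in> pv_deg p" and "B \<in> pv_deg q"
  shows "contract_left i A \<and>\<^sub>W B = (-1) ^ ((p + 1) * q) *s (B \<and>\<^sub>W contract_left i A)"
proof (cases p)
  case 0
  then show ?thesis
    using assms(1) by (simp add: contract_left_deg_0)
next
  case (Suc k)
  have "contract_left i A \<and>\<^sub>W B = (-1) ^ (k * q) *s (B \<and>\<^sub>W contract_left i A)"
    by (rule wedge_commute) (use assms Suc pv_deg_contract_left in auto)
  also have "(-1 :: 'a coeff) ^ (k * q) = (-1) ^ ((p + 1) * q)"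
    using Suc by (simp add: power_add power_mult_distrib flip: power2_eq_square power_mult)
  finally show ?thesis .
qed

lemma sn_bracket_antisym:
  assumes P: "P \<in> pv_deg p" and Q: "Q \<in> pv_deg q"
  shows "sn_bracket P Q = - ((-1) ^ ((p + 1) * (q + 1)) *s sn_bracket Q P)"
proof -
  let ?\<epsilon> = "(-1 :: 'a coeff) ^ ((p + 1) * (q + 1))"
  have sq: "?\<epsilon> * ((-1) ^ (q + 1) * (-1) ^ ((q + 1) * p)) = 1" "(-1) ^ (p + 1) * (-1) ^ ((p + 1) * q) = ?\<epsilon>"
    by (simp_all add: algebra_simps flip: power_add)
  have 1: "contract_right i P \<and>\<^sub>W pv_deriv i Q = ?\<epsilon> *s (pv_deriv i Q \<and>\<^sub>W contract_left i P)" for i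
    unfolding contract_right_eq[OF P] wedge_scale_left
      wedge_commute_contract[OF P pv_deg_pv_deriv[OF Q]] vector_smult_assoc sq ..
  have "contract_right i Q \<and>\<^sub>W pv_deriv i P
      = ((-1) ^ (q + 1) * (-1) ^ ((q + 1) * p)) *s (pv_deriv i P \<and>\<^sub>W contract_left i Q)" for i
    unfolding contract_right_eq[OF Q] wedge_scale_left
      wedge_commute_contract[OF Q pv_deg_pv_deriv[OF P]] vector_smult_assoc ..
  then have 2: "?\<epsilon> *s (contract_right i Q \<and>\<^sub>W pv_deriv i P) = pv_deriv i P \<and>\<^sub>W contract_left i Q" for i
    using sq(1) by (simp only: vector_smult_assoc vector_smult_lid)
  have "- (?\<epsilon> *s sn_bracket Q P)
      = (\<Sum>i\<in>UNIV. ?\<epsilon> *s (pv_deriv i Q \<and>\<^sub>W contract_left i P) - ?\<epsilon> *s (contract_right i Q \<and>\<^sub>W pv_deriv i P))"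
    unfolding sn_bracket_def vec.scale_sum_right vec.scale_right_diff_distrib sum_negf[symmetric]
    by (simp only: minus_diff_eq)
  then show ?thesis
    unfolding 1[symmetric] 2 by (simp only: sn_bracket_def)
qed

lemma sn_bracket_leibniz:
  assumes P: "P \<in> pv_deg p" and Q: "Q \<in> pv_deg q"
  shows "sn_bracket P (Q \<and>\<^sub>W R) = sn_bracket P Q \<and>\<^sub>W R + (-1) ^ ((p + 1) * q) *s (Q \<and>\<^sub>W sn_bracket P R)"
proof -
  let ?\<epsilon> = "(-1 :: 'a coeff) ^ ((p + 1) * q)"
  have 1: "contract_right i P \<and>\<^sub>W Q = ?\<epsilon> *s (Q \<and>\<^sub>W contract_right i P)" for i
    unfolding contract_right_eq[OF P] wedge_scale_left wedge_scale_right wedge_commute_contract[OF P Q]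
      vector_smult_assoc by (simp only: mult.commute)
  have "(-1) ^ q *s (pv_deriv i P \<and>\<^sub>W Q) = ?\<epsilon> *s (Q \<and>\<^sub>W pv_deriv i P)" for i
    unfolding wedge_commute[OF pv_deg_pv_deriv[OF P] Q] vector_smult_assoc
    by (simp add: algebra_simps flip: power_add)
  then have 2: "(-1) ^ q *s (pv_deriv i P \<and>\<^sub>W Q \<and>\<^sub>W contract_left i R)
      = ?\<epsilon> *s (Q \<and>\<^sub>W pv_deriv i P \<and>\<^sub>W contract_left i R)" for i
    by (metis wedge_assoc wedge_scale_left)
  have 3: "contract_right i P \<and>\<^sub>W Q \<and>\<^sub>W pv_deriv i R = ?\<epsilon> *s (Q \<and>\<^sub>W contract_right i P \<and>\<^sub>W pv_deriv i R)" for i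
    using 1 by (metis wedge_assoc wedge_scale_left)
  have "contract_right i P \<and>\<^sub>W pv_deriv i (Q \<and>\<^sub>W R) - pv_deriv i P \<and>\<^sub>W contract_left i (Q \<and>\<^sub>W R)
      = (contract_right i P \<and>\<^sub>W pv_deriv i Q - pv_deriv i P \<and>\<^sub>W contract_left i Q) \<and>\<^sub>W R
        + ?\<epsilon> *s (Q \<and>\<^sub>W (contract_right i P \<and>\<^sub>W pv_deriv i R - pv_deriv i P \<and>\<^sub>W contract_left i R))" for i
    unfolding pv_deriv_wedge contract_left_wedge[OF Q] wedge_add_right wedge_diff_left wedge_diff_right
      wedge_scale_right vec.scale_right_diff_distrib 2 3 wedge_assoc
    by (simp only: algebra_simps)
  then show ?thesis
    by (simp only: sn_bracket_def wedge_sum_left wedge_sum_right vec.scale_sum_right sum.distrib)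
qed

lemma schouten_nijenhuis_unique:
  assumes B: "schouten_nijenhuis B" and C: "schouten_nijenhuis C"
  shows "B = C"
proof -
  note B' = B[unfolded schouten_nijenhuis_def] and C' = C[unfolded schouten_nijenhuis_def]
  have Badd: "B (P + P') Q = B P Q + B P' Q" "B P (Q + Q') = B P Q + B P Q'" for P P' Q Q'
    using B' by simp_all
  have Cadd: "C (P + P') Q = C P Q + C P' Q" "C P (Q + Q') = C P Q + C P Q'" for P P' Q Q'
    using C' by simp_all
  have Banti: "B P Q = - ((-1) ^ ((p + 1) * (q + 1)) *s B Q P)"
    if "P \<in> pv_deg p" "Q \<in> pv_deg q" for P Q p q
    using B' that by meson
  have Canti: "C P Q = - ((-1) ^ ((p + 1) * (q + 1)) *s C Q P)"
    if "P \<in> pv_deg p" "Q \<in> pv_deg q" for P Q p q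
    using C' that by meson
  have swap: "B P Q = C P Q" if "B Q P = C Q P" "P \<in> pv_deg p" "Q \<in> pv_deg q" for P Q p q
    using Banti[of P p Q q] Canti[of P p Q q] that by simp
  have Bleib: "B P (Q \<and>\<^sub>W R) = B P Q \<and>\<^sub>W R + (-1) ^ ((p + 1) * q) *s (Q \<and>\<^sub>W B P R)"
    if "P \<in> pv_deg p" "Q \<in> pv_deg q" for P Q R p q
    using B' that by meson
  have Cleib: "C P (Q \<and>\<^sub>W R) = C P Q \<and>\<^sub>W R + (-1) ^ ((p + 1) * q) *s (Q \<and>\<^sub>W C P R)"
    if "P \<in> pv_deg p" "Q \<in> pv_deg q" for P Q R p q
    using C' that by meson
  have leib: "B P (Q \<and>\<^sub>W R) = C P (Q \<and>\<^sub>W R)"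
    if "P \<in> pv_deg p" "Q \<in> pv_deg q" "B P Q = C P Q" "B P R = C P R" for P Q R p q
    using that by (simp add: Bleib[of P p Q q] Cleib[of P p Q q])
  have gen: "B P Q = C P Q"
    if P: "P \<in> pv_deg p" and on_fun: "\<And>f. B P (pv_fun f) = C P (pv_fun f)"
      and on_vec: "\<And>X. B P (pv_vec X) = C P (pv_vec X)" for P Q p
  proof (induction Q rule: pvec_induct)
    case (axis J b)
    have "finite J \<Longrightarrow> B P (axis J b) = C P (axis J b)"
    proof (induction J arbitrary: b rule: finite_induct)
      case empty
      show ?case using on_fun[of b] by (simp add: pv_fun_def)
    next
      case (insert j J)
      have "shuffle_sign {j} J * shuffle_sign {j} J = 1"
        using insert by (intro shuffle_sign_square) auto
      then have "axis (insert j J) b = pv_vec (axis j 1) \<and>\<^sub>W axis J (shuffle_sign {j} J * b)"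
        by (simp add: pv_vec_axis wedge_axis flip: mult.assoc)
      then show ?case
        using leib[OF P pv_deg_vec on_vec insert.IH] by simp
    qed
    then show ?case by simp
  qed (simp add: Badd Cadd)
  have fun_fun: "B (pv_fun f) (pv_fun g) = C (pv_fun f) (pv_fun g)" for f g
    using B' C' by simp
  have vec_fun: "B (pv_vec X) (pv_fun f) = C (pv_vec X) (pv_fun f)" for X f
    using B' C' by simp
  have vec_vec: "B (pv_vec X) (pv_vec Z) = C (pv_vec X) (pv_vec Z)" for X Z
    using B' C' by simp
  have fun_any: "B (pv_fun f) Q = C (pv_fun f) Q" for f Q
    by (rule gen[OF pv_deg_fun fun_fun swap[OF vec_fun pv_deg_fun pv_deg_vec]])
  have vec_any: "B (pv_vec X) Q = C (pv_vec X) Q" for X Q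
    by (rule gen[OF pv_deg_vec vec_fun vec_vec])
  have hom: "B P Q = C P Q" if P: "P \<in> pv_deg p" for P Q p
    by (rule gen[OF P swap[OF fun_any P pv_deg_fun] swap[OF vec_any P pv_deg_vec]])
  have "B P Q = C P Q" for P Q
  proof (induction P rule: pvec_induct)
    case (axis I a)
    then show ?case by (rule hom[OF pv_deg_axis[OF refl]])
  qed (simp add: Badd Cadd)
  then show ?thesis
    by (intro ext)
qed

theorem schouten_nijenhuis_iff: "schouten_nijenhuis B \<longleftrightarrow> B = sn_bracket"
proof -
  have "schouten_nijenhuis sn_bracket"
    unfolding schouten_nijenhuis_def
    by (intro conjI allI ballI sn_bracket_add_left sn_bracket_add_right sn_bracket_fun_fun
        sn_bracket_vec_fun sn_bracket_vec_vec sn_bracket_antisym sn_bracket_leibniz)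
  then show ?thesis
    using schouten_nijenhuis_unique by blast
qed

section \<open>Cochain complexes\<close>

definition rscale :: "real \<Rightarrow> 'n::{finite,linorder} pvec \<Rightarrow> 'n pvec" where
  "rscale c A = rconst c *s A"

interpretation pvec: vector_space "rscale :: real \<Rightarrow> 'n::{finite,linorder} pvec \<Rightarrow> 'n pvec"
  by unfold_locales
    (simp_all only: rscale_def rconst_add rconst_mult rconst_1 vec.scale_left_distrib
      vec.scale_right_distrib vector_smult_assoc vector_smult_lid)

definition cochain_complex ::
  "(nat \<Rightarrow> 'n::{finite,linorder} pvec set) \<Rightarrow> ('n pvec \<Rightarrow> 'n pvec) \<Rightarrow> bool" where
  "cochain_complex C d \<longleftrightarrow> (\<forall>p.
    pvec.subspace (C p) \<and>
    (\<forall>A\<in>C p. \<forall>B\<in>C p. d (A + B) = d A + d B) \<and>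
    (\<forall>c. \<forall>A\<in>C p. d (rscale c A) = rscale c (d A)) \<and>
    (\<forall>A\<in>C p. d A \<in> C (p + 1) \<and> d (d A) = 0))"

definition cochain_subcomplex ::
  "(nat \<Rightarrow> 'n::{finite,linorder} pvec set) \<Rightarrow> (nat \<Rightarrow> 'n pvec set) \<Rightarrow> ('n pvec \<Rightarrow> 'n pvec) \<Rightarrow> bool" where
  "cochain_subcomplex C' C d \<longleftrightarrow>
    cochain_complex C' d \<and> cochain_complex C d \<and> (\<forall>p. C' p \<subseteq> C p)"

text \<open>
  Cochains are graded by the exterior degree; above the number of variables all components are
  \<open>{0}\<close>. The vector field \<open>axis r 1\<close> is the \<open>r\<close>-th partial derivative, so \<open>real_cochains p\<close> consists of
  the polyvectors of degree \<open>p\<close> whose coefficients are power series. A potential cochain is given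
  by power series \<open>f k\<close>, of which only those with \<open>card k = p\<close> matter, as \<open>D\<inverse> \<Sum>\<^sub>k f k Y\<^sub>k\<close>.
\<close>

definition real_cochains :: "nat \<Rightarrow> 'n::{finite,linorder} pvec set" where
  "real_cochains p = range (\<lambda>f. \<Sum>k | card k = p. of_mps (f k) *s wedge_family (\<lambda>r. axis r 1) k)"

definition potential_cochain ::
  "'n::{finite,linorder} mps \<Rightarrow> ('n \<Rightarrow> 'n vfield) \<Rightarrow> nat \<Rightarrow> ('n set \<Rightarrow> 'n mps) \<Rightarrow> 'n pvec" where
  "potential_cochain D Y p f =
    inverse (of_mps D) *s (\<Sum>k | card k = p. of_mps (f k) *s wedge_family Y k)"

definition potential_cochains ::
  "'n::{finite,linorder} mps \<Rightarrow> ('n \<Rightarrow> 'n vfield) \<Rightarrow> nat \<Rightarrow> 'n pvec set" where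
  "potential_cochains D Y p = range (potential_cochain D Y p)"

definition hom_potential_cochains ::
  "'n::{finite,linorder} mps \<Rightarrow> ('n \<Rightarrow> 'n vfield) \<Rightarrow> nat \<Rightarrow> nat \<Rightarrow> 'n pvec set" where
  "hom_potential_cochains D Y p r = potential_cochain D Y p ` {f. \<forall>k. f k \<in> hom_polys r}"

end

theory Submission
  imports Defs
begin

text \<open>
  Since the \<open>Y\<^sub>i\<close> commute, \<open>\<Lambda>\<close> commutes with every \<open>Y\<^sub>k\<close>, so the Leibniz rule reduces \<open>[\<Lambda>, f Y\<^sub>k]\<close> to
  \<open>[\<Lambda>, f] \<and> Y\<^sub>k = \<Sum>\<^sub>i (X\<^sub>i f) Y\<^sub>i \<and> Y\<^sub>k\<close>. The top wedge \<open>Y\<^sub>1 \<and> \<dots> \<and> Y\<^sub>n\<close> is \<open>D \<partial>\<^sub>1 \<and> \<dots> \<and> \<partial>\<^sub>n\<close> and commutes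
  with each \<open>X\<^sub>i\<close>; comparing coefficients gives \<open>X\<^sub>i D = \<delta>\<^sub>i D\<close>, which turns \<open>X\<^sub>i (D\<inverse> P)\<close> into
  \<open>D\<inverse> (X\<^sub>i - \<delta>\<^sub>i) P\<close>. The inclusion of the real cochains comes from the Laplace expansion of \<open>D\<close>
  by complementary minors.
\<close>

section \<open>Power series and the coefficient field\<close>

lemma of_mps_0 [simp]: "of_mps 0 = 0"
  by (simp add: of_mps_def Zero_fract_def)

lemma of_mps_1 [simp]: "of_mps 1 = 1"
  by (simp add: of_mps_def One_fract_def)

lemma of_mps_add: "of_mps (f + g) = of_mps f + of_mps g"
  by (simp add: of_mps_def)

lemma of_mps_mult: "of_mps (f * g) = of_mps f * of_mps g"
  by (simp add: of_mps_def)

lemma of_mps_diff: "of_mps (f - g) = of_mps f - of_mps g"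
  by (simp add: of_mps_def)

lemma of_mps_eq_iff [simp]: "of_mps f = of_mps g \<longleftrightarrow> f = g"
  by (simp add: of_mps_def eq_fract)

lemma of_mps_eq_0_iff [simp]: "of_mps f = 0 \<longleftrightarrow> f = 0"
  using of_mps_eq_iff[of f 0] by (simp del: of_mps_eq_iff)

lemma of_mps_sum: "of_mps (sum f A) = (\<Sum>x\<in>A. of_mps (f x))"
  by (induction A rule: infinite_finite_induct) (simp_all add: of_mps_add)

lemma of_mps_prod: "of_mps (prod f A) = (\<Prod>x\<in>A. of_mps (f x))"
  by (induction A rule: infinite_finite_induct) (simp_all add: of_mps_mult)

lemma of_mps_of_int: "of_mps (of_int z) = of_int z"
proof -
  have nat: "of_mps (of_nat m) = of_nat m" for m
    by (induction m) (simp_all add: of_mps_add)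
  show ?thesis
    by (cases z rule: int_diff_cases) (simp add: of_mps_diff nat)
qed

lemma of_mps_det:
  "of_mps (det A) = det (\<chi> i r. of_mps (A $ i $ r))"
  by (simp add: det_def of_mps_sum of_mps_mult of_mps_prod of_mps_of_int)

lemma rconst_0 [simp]: "rconst 0 = 0"
  using rconst_add[of 0 0] by (simp only: add_0_right add_cancel_right_right)

lemma rconst_uminus: "rconst (- c) = - rconst c"
  by (rule add_eq_0_iff[THEN iffD1]) (simp flip: rconst_add)

lemma rconst_sum: "rconst (sum f A) = (\<Sum>x\<in>A. rconst (f x))"
  by (induction A rule: infinite_finite_induct) (simp_all add: rconst_add)

lemma rconst_power: "rconst (c ^ m) = rconst c ^ m"
  by (induction m) (simp_all add: rconst_mult)

text \<open>The real-valued version of \<open>shuffle_sign\<close>, which lives in the fraction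
  field. As a real number the sign can also be turned into a constant power series, as
  \<open>potential_differential\<close> requires.\<close>

definition shuffle_const :: "'n::{finite,linorder} set \<Rightarrow> 'n set \<Rightarrow> real" where
  "shuffle_const I J = (if I \<inter> J = {} then (-1) ^ card {(i, j). i \<in> I \<and> j \<in> J \<and> j < i} else 0)"

lemma shuffle_sign_eq_rconst: "shuffle_sign I J = rconst (shuffle_const I J)"
  by (simp add: shuffle_sign_def shuffle_const_def rconst_power rconst_uminus)

text \<open>The power series ring as a subset of its fraction field. Membership expresses that a
  coefficient has no denominator, which is what distinguishes real cochains.\<close>

definition mps_coeffs :: "'n::{finite,linorder} coeff set" where
  "mps_coeffs = range of_mps"

lemma mps_coeffs_of_mps [simp, intro]: "of_mps f \<in> mps_coeffs"
  by (simp add: mps_coeffs_def)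

lemma mps_coeffs_0 [simp, intro]: "0 \<in> mps_coeffs"
  using mps_coeffs_of_mps[of 0] by simp

lemma mps_coeffs_1 [simp, intro]: "1 \<in> mps_coeffs"
  using mps_coeffs_of_mps[of 1] by simp

lemma mps_coeffs_rconst [simp, intro]: "rconst c \<in> mps_coeffs"
  by (simp add: rconst_def)

lemma mps_coeffs_add: "a \<in> mps_coeffs \<Longrightarrow> b \<in> mps_coeffs \<Longrightarrow> a + b \<in> mps_coeffs"
  by (auto simp: mps_coeffs_def simp flip: of_mps_add)

lemma mps_coeffs_diff: "a \<in> mps_coeffs \<Longrightarrow> b \<in> mps_coeffs \<Longrightarrow> a - b \<in> mps_coeffs"
  by (auto simp: mps_coeffs_def simp flip: of_mps_diff)

lemma mps_coeffs_mult: "a \<in> mps_coeffs \<Longrightarrow> b \<in> mps_coeffs \<Longrightarrow> a * b \<in> mps_coeffs"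
  by (auto simp: mps_coeffs_def simp flip: of_mps_mult)

lemma mps_coeffs_sum: "(\<And>x. x \<in> A \<Longrightarrow> f x \<in> mps_coeffs) \<Longrightarrow> sum f A \<in> mps_coeffs"
  by (induction A rule: infinite_finite_induct) (auto intro: mps_coeffs_add)

lemma mps_coeffs_coeff_deriv: "a \<in> mps_coeffs \<Longrightarrow> coeff_deriv i a \<in> mps_coeffs"
  by (auto simp: mps_coeffs_def coeff_deriv_of_mps)

lemma mps_coeffs_shuffle_sign: "shuffle_sign I J \<in> mps_coeffs"
  by (simp add: shuffle_sign_eq_rconst)

section \<open>Partial derivatives and vector fields as derivations of the fraction field\<close>

lemma coeff_deriv_sum: "coeff_deriv i (sum f A) = (\<Sum>x\<in>A. coeff_deriv i (f x))"
  by (induction A rule: infinite_finite_induct) (simp_all add: coeff_deriv_add)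

lemma mps_deriv_const: "mps_deriv i (mps_const c) = 0"
proof (rule mps_eqI)
  fix m
  have "Poly_Mapping.lookup (m + Poly_Mapping.single i 1) i = Suc (Poly_Mapping.lookup m i)"
    by (simp add: lookup_add)
  then have "m + Poly_Mapping.single i (1::nat) \<noteq> 0"
    by force
  then show "mps_nth (mps_deriv i (mps_const c)) m = mps_nth 0 m"
    by (simp add: mps_deriv.rep_eq mps_const.rep_eq zero_mps.rep_eq)
qed

lemma coeff_deriv_rconst [simp]: "coeff_deriv i (rconst c) = 0"
  by (simp add: rconst_def coeff_deriv_of_mps mps_deriv_const)

lemma coeff_deriv_rconst_mult: "coeff_deriv i (rconst c * f) = rconst c * coeff_deriv i f"
  by (simp add: coeff_deriv_mult)

lemma mps_deriv_commute: "mps_deriv i (mps_deriv j f) = mps_deriv j (mps_deriv i f)"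
  by (rule mps_eqI) (auto simp: mps_deriv.rep_eq lookup_add lookup_single when_def ac_simps)

text \<open>The commutator of two derivations is again a derivation. It vanishes on power series, so
  applying it to \<open>f * of_mps b = of_mps a\<close> forces it to vanish on the fraction
  \<open>f\<close>.\<close>

lemma coeff_deriv_commute: "coeff_deriv i (coeff_deriv j f) = coeff_deriv j (coeff_deriv i f)"
proof -
  define c where "c g = coeff_deriv i (coeff_deriv j g) - coeff_deriv j (coeff_deriv i g)" for g
  have c_mult: "c (g * h) = c g * h + g * c h" for g h
    by (simp add: c_def coeff_deriv_mult coeff_deriv_add algebra_simps)
  have c_mps: "c (of_mps g) = 0" for g
    by (simp add: c_def coeff_deriv_of_mps mps_deriv_commute[of i j])
  obtain a b where f: "f = Fract a b" and b: "b \<noteq> 0"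
    by (cases f)
  have "f * of_mps b = of_mps a"
    using b by (simp add: f of_mps_def eq_fract)
  then have "c f * of_mps b = 0"
    using c_mult[of f "of_mps b"] by (simp add: c_mps)
  then show ?thesis
    using b by (simp add: c_def)
qed

lemma vf_apply_scale_left: "vf_apply (c *s X) f = c * vf_apply X f"
  by (simp add: vf_apply_def sum_distrib_left mult.assoc)

lemma vf_apply_sum_left: "vf_apply (\<Sum>j\<in>J. X j) f = (\<Sum>j\<in>J. vf_apply (X j) f)"
  unfolding vf_apply_def by (subst sum.swap) (simp add: sum_distrib_right)

lemma vf_apply_sum_right: "vf_apply X (\<Sum>j\<in>J. f j) = (\<Sum>j\<in>J. vf_apply X (f j))"
  unfolding vf_apply_def by (subst sum.swap) (simp add: coeff_deriv_sum sum_distrib_left)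

lemma vf_apply_mult: "vf_apply X (f * g) = vf_apply X f * g + f * vf_apply X g"
  by (simp add: vf_apply_def coeff_deriv_mult sum_distrib_left sum_distrib_right sum.distrib algebra_simps)

lemma vf_apply_rconst_mult: "vf_apply X (rconst c * f) = rconst c * vf_apply X f"
  by (simp add: vf_apply_def coeff_deriv_rconst_mult sum_distrib_left mult.left_commute)

text \<open>Obtained by differentiating \<open>inverse f * f = 1\<close>.\<close>

lemma vf_apply_inverse:
  assumes "f \<noteq> 0"
  shows "vf_apply X (inverse f) = - inverse f * inverse f * vf_apply X f"
proof -
  have "vf_apply X 1 = 0"
    by (simp add: vf_apply_def)
  then have "vf_apply X (inverse f) * f + inverse f * vf_apply X f = 0"
    using vf_apply_mult[of X "inverse f" f] assms by simp
  then have "vf_apply X (inverse f) * f = - (inverse f * vf_apply X f)"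
    by (simp add: add_eq_0_iff2)
  then have "vf_apply X (inverse f) * (f * inverse f) = - (inverse f * vf_apply X f) * inverse f"
    by (simp only: mult.assoc[symmetric])
  then show ?thesis
    using assms by (simp add: ac_simps)
qed

lemma vf_apply_lie_bracket:
  "vf_apply (lie_bracket X Z) f = vf_apply X (vf_apply Z f) - vf_apply Z (vf_apply X f)"
proof -
  \<comment> \<open>A composite of two fields splits into a first-order and a second-order part. The
    second-order part is symmetric in the two fields because partial derivatives commute, so it
    cancels in the commutator.\<close>
  have second: "vf_apply U (vf_apply V f) = (\<Sum>s\<in>UNIV. vf_apply U (V $ s) * coeff_deriv s f)
      + (\<Sum>s\<in>UNIV. \<Sum>r\<in>UNIV. U $ r * V $ s * coeff_deriv r (coeff_deriv s f))" for U V
  proof -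
    have "vf_apply U (vf_apply V f) = (\<Sum>s\<in>UNIV. vf_apply U (V $ s * coeff_deriv s f))"
      unfolding vf_apply_def[of V] vf_apply_sum_right ..
    also have "\<dots> = (\<Sum>s\<in>UNIV. vf_apply U (V $ s) * coeff_deriv s f + V $ s * vf_apply U (coeff_deriv s f))"
      by (simp only: vf_apply_mult)
    finally show ?thesis
      by (simp add: sum.distrib vf_apply_def[of U "coeff_deriv _ f"] sum_distrib_left algebra_simps)
  qed
  have "(\<Sum>s\<in>UNIV. \<Sum>r\<in>UNIV. X $ r * Z $ s * coeff_deriv r (coeff_deriv s f))
      = (\<Sum>s\<in>UNIV. \<Sum>r\<in>UNIV. Z $ r * X $ s * coeff_deriv r (coeff_deriv s f))"
    by (subst sum.swap) (simp add: coeff_deriv_commute mult.commute)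
  then have "vf_apply X (vf_apply Z f) - vf_apply Z (vf_apply X f)
      = (\<Sum>s\<in>UNIV. vf_apply X (Z $ s) * coeff_deriv s f) - (\<Sum>s\<in>UNIV. vf_apply Z (X $ s) * coeff_deriv s f)"
    unfolding second by (simp only: add_diff_add diff_self add_0_right)
  then show ?thesis
    unfolding vf_apply_def[of "lie_bracket X Z"] by (simp add: lie_bracket_def left_diff_distrib sum_subtractf)
qed


section \<open>The wedge algebra of a family of vector fields\<close>

text \<open>The field contains the real constant 1/2, so 2 is invertible. Antisymmetry arguments for
  polyvectors rest on this.\<close>

lemma coeff_eq_neg_imp_0:
  assumes "(a :: 'n::{finite,linorder} coeff) = - a"
  shows "a = 0"
proof -
  have "a = (rconst (1/2) + rconst (1/2)) * a"
    by (simp flip: rconst_add)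
  also have "\<dots> = rconst (1/2) * (a + a)"
    by (simp add: algebra_simps)
  also have "a + a = 0"
    using assms by (simp add: eq_neg_iff_add_eq_0)
  finally show ?thesis by simp
qed

lemma pvec_eq_neg_imp_0: "(A :: 'n::{finite,linorder} pvec) = - A \<Longrightarrow> A = 0"
  by (metis coeff_eq_neg_imp_0 vec_eq_iff vector_uminus_component zero_index)

lemma pv_deg_scale: "A \<in> pv_deg p \<Longrightarrow> c *s A \<in> pv_deg p"
  by (auto simp: pv_deg_def)

lemma pv_deg_wedge:
  assumes "A \<in> pv_deg p" and "B \<in> pv_deg q"
  shows "A \<and>\<^sub>W B \<in> pv_deg (p + q)"
  using assms(1)
proof (induction A rule: pv_deg_induct)
  case (axis I a)
  from assms(2) show ?case
  proof (induction B rule: pv_deg_induct)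
    case (axis J b)
    then show ?case
      using \<open>card I = p\<close>
      by (cases "I \<inter> J = {}") (auto simp: wedge_axis card_Un_disjoint shuffle_sign_def intro: pv_deg_axis)
  qed (auto simp: wedge_add_right intro: pv_deg_add)
qed (auto simp: wedge_add_left intro: pv_deg_add)

lemma wedge_vec_commute: "pv_vec X \<and>\<^sub>W pv_vec Z = - (pv_vec Z \<and>\<^sub>W pv_vec X)"
  using wedge_commute[OF pv_deg_vec pv_deg_vec, of X Z] by simp

lemma wedge_vec_left_commute:
  "pv_vec X \<and>\<^sub>W pv_vec Z \<and>\<^sub>W A = - (pv_vec Z \<and>\<^sub>W pv_vec X \<and>\<^sub>W A)"
  unfolding wedge_assoc[symmetric] wedge_uminus_left[symmetric] wedge_vec_commute[of X Z] ..

lemma wedge_vec_self: "pv_vec X \<and>\<^sub>W pv_vec X \<and>\<^sub>W A = 0"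
  by (rule pvec_eq_neg_imp_0) (rule wedge_vec_left_commute)

section \<open>Sorted wedges of a family of vector fields\<close>

lemma wedge_family_cong: "(\<And>i. i \<in> k \<Longrightarrow> Z i = Z' i) \<Longrightarrow> wedge_family Z k = wedge_family Z' k"
  unfolding wedge_family_def by (rule foldr_cong) auto

lemma wedge_family_empty [simp]: "wedge_family Z {} = pv_fun 1"
  by (simp add: wedge_family_def)

text \<open>A new minimum becomes the head of the sorted list, so the fold unfolds once. With
  \<open>finite_linorder_min_induct\<close> this gives induction on the index set without touching
  lists again.\<close>

lemma wedge_family_insert_min:
  assumes "\<forall>a\<in>k. b < a"
  shows "wedge_family Z (insert b k) = pv_vec (Z b) \<and>\<^sub>W wedge_family Z k"
proof -
  have "sorted_list_of_set (insert b k) = insort b (sorted_list_of_set k)"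
    using assms by (intro sorted_list_of_set_insert) auto
  also have "\<dots> = b # sorted_list_of_set k"
    using assms by (intro insort_is_Cons) (auto simp: less_imp_le)
  finally show ?thesis
    by (simp add: wedge_family_def)
qed

lemma shuffle_sign_less: "\<forall>a\<in>k. b < a \<Longrightarrow> shuffle_sign {b} k = 1"
proof -
  assume k: "\<forall>a\<in>k. b < a"
  then have "{(i, j). i \<in> {b} \<and> j \<in> k \<and> j < i} = {}" and "{b} \<inter> k = {}"
    by force+
  then show ?thesis
    by (simp only: shuffle_sign_def) simp
qed

lemma shuffle_sign_greater: "b < a \<Longrightarrow> shuffle_sign {a} {b} = -1"
proof -
  assume "b < a"
  then have "{(i, j). i \<in> {a} \<and> j \<in> {b} \<and> j < i} = {(a, b)}" by auto
  then show ?thesis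
    using \<open>b < a\<close> by (simp add: shuffle_sign_def)
qed

text \<open>The new factor moves right past every smaller index, and each exchange costs one sign,
  matching the inversions counted by \<open>shuffle_sign\<close>. If \<open>a\<close> already occurs
  in \<open>k\<close>, the sign is 0 and the wedge has a repeated factor.\<close>

lemma wedge_vec_family:
  "pv_vec (Z a) \<and>\<^sub>W wedge_family Z k = shuffle_sign {a} k *s wedge_family Z (insert a k)"
proof (induction k rule: finite_linorder_min_induct[OF finite])
  case 1
  then show ?case
    using wedge_family_insert_min[of "{}" a Z] by simp
next
  case (2 b k)
  consider "a < b" | "a = b" | "b < a" by fastforce
  then show ?case
  proof cases
    case 1
    then have "\<forall>c\<in>insert b k. a < c"
      using 2(2) by auto
    then show ?thesis
      by (simp add: wedge_family_insert_min shuffle_sign_less)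
  next
    case 2
    then show ?thesis
      by (simp add: wedge_family_insert_min[OF \<open>\<forall>a\<in>k. b < a\<close>] wedge_vec_self shuffle_sign_def)
  next
    case 3
    have "shuffle_sign {a} ({b} \<union> k) = shuffle_sign {a} {b} * shuffle_sign {a} k"
      using 2(2) by (intro shuffle_sign_Un_right) auto
    then have sign: "shuffle_sign {a} (insert b k) = - shuffle_sign {a} k"
      by (simp add: shuffle_sign_greater[OF 3])
    have "pv_vec (Z a) \<and>\<^sub>W wedge_family Z (insert b k)
        = - (pv_vec (Z b) \<and>\<^sub>W pv_vec (Z a) \<and>\<^sub>W wedge_family Z k)"
      unfolding wedge_family_insert_min[OF 2(2)] by (rule wedge_vec_left_commute)
    also have "\<dots> = - shuffle_sign {a} k *s (pv_vec (Z b) \<and>\<^sub>W wedge_family Z (insert a k))"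
      by (simp add: 2(3) wedge_scale_right)
    also have "pv_vec (Z b) \<and>\<^sub>W wedge_family Z (insert a k) = wedge_family Z (insert a (insert b k))"
      using 2(2) 3 by (simp add: insert_commute[of a b] wedge_family_insert_min)
    finally show ?thesis
      by (simp only: sign)
  qed
qed

text \<open>Induction on \<open>k\<close>: its least factor is put back by
  \<open>wedge_vec_family\<close>, and the two signs merge by the cocycle identity
  \<open>shuffle_sign_assoc\<close>.\<close>

lemma wedge_family_wedge:
  "wedge_family Z k \<and>\<^sub>W wedge_family Z l = shuffle_sign k l *s wedge_family Z (k \<union> l)"
proof (induction k rule: finite_linorder_min_induct[OF finite])
  case 1
  then show ?case by (simp add: wedge_fun_left)
next
  case (2 b k)
  have "wedge_family Z (insert b k) \<and>\<^sub>W wedge_family Z l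
      = (shuffle_sign k l * shuffle_sign {b} (k \<union> l)) *s wedge_family Z (insert b k \<union> l)"
    unfolding wedge_family_insert_min[OF 2(2)]
    unfolding wedge_assoc 2(3) by (simp add: wedge_scale_right wedge_vec_family)
  also have "shuffle_sign k l * shuffle_sign {b} (k \<union> l) = shuffle_sign (insert b k) l"
    using shuffle_sign_assoc[of "{b}" k l] by (simp add: shuffle_sign_less[OF 2(2)])
  finally show ?case .
qed

lemma pv_deg_family: "wedge_family Z k \<in> pv_deg (card k)"
proof (induction k rule: finite_linorder_min_induct[OF finite])
  case 1
  then show ?case by (simp add: pv_deg_fun)
next
  case (2 b k)
  have "b \<notin> k"
    using 2(2) by auto
  then show ?case
    using pv_deg_wedge[OF pv_deg_vec 2(3), of "Z b"] by (simp add: wedge_family_insert_min[OF 2(2)])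
qed

lemma wedge_family_axis: "wedge_family (\<lambda>r. axis r 1) k = axis k 1"
proof (induction k rule: finite_linorder_min_induct[OF finite])
  case 1
  then show ?case by (simp add: pv_fun_def)
next
  case (2 b k)
  then show ?case
    by (simp add: wedge_family_insert_min[OF 2(2)] pv_vec_axis wedge_axis shuffle_sign_less)
qed

text \<open>The scalar \<open>c\<close> and the remainder \<open>l\<close> are chosen before
  \<open>Z\<close>, so two different families can be compared through the same factorization, as
  needed when two members are swapped.\<close>

lemma wedge_family_pair:
  assumes "a \<noteq> b" "a \<in> k" "b \<in> k"
  obtains c l where "a \<notin> l" "b \<notin> l"
    "\<And>Z. wedge_family Z k = c *s (pv_vec (Z a) \<and>\<^sub>W pv_vec (Z b) \<and>\<^sub>W wedge_family Z l)"
proof -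
  define l where "l = k - {a, b}"
  define c where "c = shuffle_sign {b} l * shuffle_sign {a} (insert b l)"
  have k: "insert a (insert b l) = k"
    using assms by (auto simp: l_def)
  \<comment> \<open>Reinserting \<open>b\<close> and then \<open>a\<close> produces the sign
    \<open>c\<close>; since its square is 1, the same \<open>c\<close> serves to invert the
    relation.\<close>
  have "c * c = (shuffle_sign {b} l * shuffle_sign {b} l) *
      (shuffle_sign {a} (insert b l) * shuffle_sign {a} (insert b l))"
    by (simp add: c_def ac_simps)
  also have "\<dots> = 1"
    using assms by (subst (1 2) shuffle_sign_square) (auto simp: l_def)
  finally have "c * c = 1" .
  then have "wedge_family Z k = c *s (pv_vec (Z a) \<and>\<^sub>W pv_vec (Z b) \<and>\<^sub>W wedge_family Z l)" for Z
    using k by (simp add: wedge_vec_family wedge_scale_right flip: c_def)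
  then show thesis
    using that[of l c] by (auto simp: l_def)
qed

lemma wedge_family_repeated:
  assumes "a \<noteq> b" "a \<in> k" "b \<in> k" "Z a = Z b"
  shows "wedge_family Z k = 0"
  by (rule wedge_family_pair[OF assms(1-3)]) (simp add: assms(4) wedge_vec_self)

lemma wedge_family_transpose:
  assumes "a \<noteq> b" "a \<in> k" "b \<in> k"
  shows "wedge_family (Z \<circ> Transposition.transpose a b) k = - wedge_family Z k"
proof (rule wedge_family_pair[OF assms])
  fix c l
  assume l: "a \<notin> l" "b \<notin> l"
    and k: "\<And>Z. wedge_family Z k = c *s (pv_vec (Z a) \<and>\<^sub>W pv_vec (Z b) \<and>\<^sub>W wedge_family Z l)"
  have "wedge_family (Z \<circ> Transposition.transpose a b) l = wedge_family Z l"
    using l by (intro wedge_family_cong) (auto simp: Transposition.transpose_def)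
  then show ?thesis
    unfolding k by (simp add: wedge_vec_left_commute[of "Z b"])
qed

text \<open>Multilinearity: \<open>f\<close> records which summand each factor contributes.\<close>

lemma wedge_family_expand:
  "wedge_family (\<lambda>i. \<Sum>r\<in>UNIV. c i r *s e r) k
    = (\<Sum>f\<in>k \<rightarrow>\<^sub>E UNIV. (\<Prod>i\<in>k. c i (f i)) *s wedge_family (e \<circ> f) k)"
proof (induction k rule: finite_linorder_min_induct[OF finite])
  case 1
  then show ?case by simp
next
  case (2 b k)
  have b: "b \<notin> k"
    using 2(2) by auto
  let ?g = "\<lambda>f k. (\<Prod>i\<in>k. c i (f i)) *s wedge_family (e \<circ> f) k"
  have step: "?g (f(b := r)) (insert b k) = (c b r *s pv_vec (e r)) \<and>\<^sub>W ?g f k" for f r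
  proof -
    have "wedge_family (e \<circ> f(b := r)) k = wedge_family (e \<circ> f) k"
      using b by (intro wedge_family_cong) auto
    moreover have "(\<Prod>i\<in>k. c i ((f(b := r)) i)) = (\<Prod>i\<in>k. c i (f i))"
      using b by (intro prod.cong) auto
    ultimately show ?thesis
      using b by (simp add: wedge_family_insert_min[OF 2(2)] wedge_scale_left wedge_scale_right
          vector_smult_assoc mult.commute)
  qed
  \<comment> \<open>A choice function on \<open>insert b k\<close> is a value \<open>r\<close> at
    \<open>b\<close> together with a choice function on \<open>k\<close>.\<close>
  have "(\<Sum>f\<in>insert b k \<rightarrow>\<^sub>E UNIV. ?g f (insert b k))
      = (\<Sum>(r, f)\<in>UNIV \<times> (k \<rightarrow>\<^sub>E UNIV). ?g (f(b := r)) (insert b k))"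
    unfolding PiE_insert_eq
    by (subst sum.reindex) (use inj_combinator[OF b, of "\<lambda>_. UNIV"] in \<open>auto simp: case_prod_unfold\<close>)
  also have "\<dots> = (\<Sum>r\<in>UNIV. \<Sum>f\<in>k \<rightarrow>\<^sub>E UNIV. (c b r *s pv_vec (e r)) \<and>\<^sub>W ?g f k)"
    unfolding step by (rule sum.cartesian_product[symmetric])
  also have "\<dots> = pv_vec (\<Sum>r\<in>UNIV. c b r *s e r) \<and>\<^sub>W (\<Sum>f\<in>k \<rightarrow>\<^sub>E UNIV. ?g f k)"
    unfolding pv_vec_sum pv_vec_scale wedge_sum_left wedge_sum_right by (rule sum.swap)
  finally show ?case
    unfolding wedge_family_insert_min[OF 2(2)] 2(3) ..
qed

text \<open>The permutation is built from transpositions, each of which negates both the wedge and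
  the sign.\<close>

lemma wedge_family_permutes:
  assumes "p permutes (UNIV :: 'n set)"
  shows "wedge_family (\<lambda>i. axis (p i) 1) (UNIV :: 'n::{finite,linorder} set) = axis UNIV (of_int (sign p))"
  using finite assms
proof (induction p rule: permutes_rev_induct)
  case id
  then show ?case by (simp add: wedge_family_axis sign_id)
next
  case (swap a b p)
  have "permutation p"
    using swap by (auto simp: permutation_permutes)
  then have sign: "sign (p \<circ> Transposition.transpose a b) = - sign p"
    using swap by (simp add: sign_compose permutation_swap_id sign_swap_id)
  have "wedge_family ((\<lambda>i. axis (p i) 1) \<circ> Transposition.transpose a b) UNIV = - axis UNIV (of_int (sign p))"
    using swap by (subst wedge_family_transpose) auto
  then show ?case
    unfolding sign by (simp add: comp_def axis_uminus)
qed

text \<open>Expanding every field in coordinates gives a sum over all maps of the index type. Maps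
  with a repeated value drop out, and what remains is the Leibniz formula of the
  determinant.\<close>

lemma wedge_family_UNIV:
  "wedge_family Z (UNIV :: 'n::{finite,linorder} set) = axis UNIV (det (\<chi> i. Z i))"
proof -
  have Z: "Z = (\<lambda>i. \<Sum>r\<in>UNIV. Z i $ r *s axis r 1)"
    by (simp add: basis_expansion)
  let ?g = "\<lambda>f. (\<Prod>i\<in>UNIV. Z i $ f i) *s wedge_family (\<lambda>i. axis (f i) 1) (UNIV :: 'n set)"
  have zero: "?g f = 0" if "\<not> f permutes (UNIV :: 'n set)" for f
  proof -
    \<comment> \<open>On a finite type an injective self-map is a permutation.\<close>
    have "\<not> inj f"
      using that by (metis finite_UNIV_inj_surj bij_def bij_imp_permutes UNIV_I finite)
    then obtain a b where "a \<noteq> b" "f a = f b"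
      by (auto simp: inj_def)
    then show ?thesis
      by (simp add: wedge_family_repeated[of a b])
  qed
  have "wedge_family Z UNIV = (\<Sum>f\<in>UNIV. ?g f)"
    by (subst Z) (simp add: wedge_family_expand comp_def)
  also have "\<dots> = (\<Sum>f | f permutes (UNIV :: 'n set). ?g f)"
    by (rule sum.mono_neutral_right) (use zero in auto)
  also have "\<dots> = (\<Sum>f | f permutes (UNIV :: 'n set). axis UNIV (of_int (sign f) * (\<Prod>i\<in>UNIV. Z i $ f i)))"
    by (rule sum.cong) (simp_all add: wedge_family_permutes mult.commute flip: axis_scale)
  also have "\<dots> = axis UNIV (det (\<chi> i. Z i))"
    by (simp add: det_def vec_eq_iff axis_def)
  finally show ?thesis .
qed


section \<open>The bracket with a Poisson tensor\<close>

lemma pv_deriv_scale: "pv_deriv i (c *s A) = coeff_deriv i c *s A + c *s pv_deriv i A"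
  by (simp add: pv_deriv_def vec_eq_iff coeff_deriv_mult)

lemma contract_left_scale: "contract_left i (c *s A) = c *s contract_left i A"
  by (simp add: contract_left_def vec_eq_iff)

lemma contract_right_scale: "contract_right i (c *s A) = c *s contract_right i A"
  by (simp add: contract_right_def vec_eq_iff)

lemma sn_bracket_rconst_left: "sn_bracket (rconst c *s P) Q = rconst c *s sn_bracket P Q"
  by (simp add: sn_bracket_def pv_deriv_scale contract_right_scale wedge_scale_left
      vec.scale_sum_right vec.scale_right_diff_distrib)

lemma sn_bracket_rconst_right: "sn_bracket P (rconst c *s Q) = rconst c *s sn_bracket P Q"
  by (simp add: sn_bracket_def pv_deriv_scale contract_left_scale wedge_scale_right
      vec.scale_sum_right vec.scale_right_diff_distrib)

lemma sn_bracket_0_left [simp]: "sn_bracket 0 Q = 0"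
  using sn_bracket_add_left[of 0 0 Q] by simp

lemma sn_bracket_0_right [simp]: "sn_bracket P 0 = 0"
  using sn_bracket_add_right[of P 0 0] by simp

lemma sn_bracket_sum_left: "sn_bracket (sum f A) Q = (\<Sum>x\<in>A. sn_bracket (f x) Q)"
  by (induction A rule: infinite_finite_induct) (simp_all add: sn_bracket_add_left)

lemma sn_bracket_sum_right: "sn_bracket P (sum f A) = (\<Sum>x\<in>A. sn_bracket P (f x))"
  by (induction A rule: infinite_finite_induct) (simp_all add: sn_bracket_add_right)

lemma sn_bracket_fun_1: "sn_bracket P (pv_fun 1) = 0"
proof -
  have "pv_fun 0 = (0 :: 'a pvec)"
    by (simp add: pv_fun_def)
  then show ?thesis
    by (simp add: sn_bracket_def pv_deriv_fun)
qed

text \<open>By the Leibniz rule, an element that brackets to zero with every factor brackets to zero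
  with their wedge.\<close>

lemma sn_bracket_wedge_family_eq_0:
  assumes "P \<in> pv_deg p" and "\<And>i. sn_bracket P (pv_vec (Z i)) = 0"
  shows "sn_bracket P (wedge_family Z k) = 0"
proof (induction k rule: finite_linorder_min_induct[OF finite])
  case 1
  then show ?case by (simp add: sn_bracket_fun_1)
next
  case (2 b k)
  then show ?case
    unfolding wedge_family_insert_min[OF 2(2)] sn_bracket_leibniz[OF assms(1) pv_deg_vec]
    by (simp add: assms(2))
qed

text \<open>This is the Lie derivative of a top-degree polyvector. The contraction removes the
  \<open>r\<close>-th coordinate field, and only the \<open>r\<close>-th component of the
  differentiated field can restore it, which leaves the divergence.\<close>

lemma sn_bracket_vec_top:
  "sn_bracket (pv_vec V) (axis UNIV g) = axis UNIV (vf_apply V g - divergence V * g)"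
proof -
  have "pv_vec (\<chi> q. coeff_deriv r (V $ q)) \<and>\<^sub>W contract_left r (axis UNIV g)
      = axis UNIV (coeff_deriv r (V $ r) * g)" for r
  proof -
    let ?s = "shuffle_sign {r} (UNIV - {r}) :: 'a coeff"
    have "pv_vec (\<chi> q. coeff_deriv r (V $ q)) \<and>\<^sub>W contract_left r (axis UNIV g)
        = (\<Sum>q\<in>UNIV. axis {q} (coeff_deriv r (V $ q)) \<and>\<^sub>W axis (UNIV - {r}) (?s * g))"
      by (simp add: pv_vec_def contract_left_axis wedge_sum_left)
    \<comment> \<open>For \<open>q\<close> other than \<open>r\<close> the coordinate field is
      repeated; for \<open>q = r\<close> the signs of contraction and wedge cancel.\<close>
    also have "\<dots> = (\<Sum>q\<in>UNIV. if q = r then axis UNIV (coeff_deriv r (V $ r) * g) else 0)"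
    proof (rule sum.cong[OF refl])
      fix q
      have "?s * ?s = 1"
        by (rule shuffle_sign_square) simp
      then have "?s * coeff_deriv r (V $ r) * (?s * g) = coeff_deriv r (V $ r) * g"
        by algebra
      then show "axis {q} (coeff_deriv r (V $ q)) \<and>\<^sub>W axis (UNIV - {r}) (?s * g)
          = (if q = r then axis UNIV (coeff_deriv r (V $ r) * g) else 0)"
        by (cases "q = r") (simp only: wedge_axis, simp, simp add: wedge_axis shuffle_sign_def)
    qed
    finally show ?thesis by simp
  qed
  then have "sn_bracket (pv_vec V) (axis UNIV g)
      = (\<Sum>r\<in>UNIV. axis UNIV (V $ r * coeff_deriv r g) - axis UNIV (coeff_deriv r (V $ r) * g))"
    by (simp add: sn_bracket_def contract_right_vec pv_deriv_axis pv_deriv_vec wedge_fun_left axis_scale)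
  also have "\<dots> = axis UNIV (vf_apply V g - divergence V * g)"
    by (simp add: vf_apply_def divergence_def sum_distrib_right sum_subtractf vec_eq_iff axis_def)
  finally show ?thesis .
qed

text \<open>The bracket of \<open>V\<close> with the top wedge of the family is evaluated twice: it
  is zero by the Leibniz rule, and \<open>sn_bracket_vec_top\<close> gives its only
  component.\<close>

lemma vf_apply_det:
  fixes Y :: "'n::{finite,linorder} \<Rightarrow> 'n vfield"
  assumes "\<And>i. lie_bracket V (Y i) = 0"
  shows "vf_apply V (det (\<chi> i. Y i)) = divergence V * det (\<chi> i. Y i)"
proof -
  have "sn_bracket (pv_vec V) (wedge_family Y UNIV) = 0"
    by (rule sn_bracket_wedge_family_eq_0[OF pv_deg_vec]) (simp add: sn_bracket_vec_vec assms)
  then show ?thesis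
    by (simp add: wedge_family_UNIV sn_bracket_vec_top axis_eq_0_iff)
qed

section \<open>Brackets with a decomposable bivector\<close>

lemma pv_deg_wedge_vec_vec: "pv_vec V \<and>\<^sub>W pv_vec W \<in> pv_deg 2"
  using pv_deg_wedge[OF pv_deg_vec pv_deg_vec, of V W] by (simp add: numeral_2_eq_2)

lemma sn_bracket_fun_vec: "sn_bracket (pv_fun f) (pv_vec V) = - pv_fun (vf_apply V f)"
  using sn_bracket_antisym[OF pv_deg_fun pv_deg_vec, of f V] by (simp add: sn_bracket_vec_fun)

lemma sn_bracket_bivec_fun:
  "sn_bracket (pv_vec V \<and>\<^sub>W pv_vec W) (pv_fun f) = vf_apply W f *s pv_vec V - vf_apply V f *s pv_vec W"
proof -
  \<comment> \<open>The Leibniz rule acts in the second slot, so the bivector is moved there. The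
    exponent \<open>(2 + 1) * (0 + 1)\<close> is odd, and its sign cancels the minus of the
    antisymmetry rule.\<close>
  have "sn_bracket (pv_vec V \<and>\<^sub>W pv_vec W) (pv_fun f) = sn_bracket (pv_fun f) (pv_vec V \<and>\<^sub>W pv_vec W)"
    using sn_bracket_antisym[OF pv_deg_wedge_vec_vec pv_deg_fun, of V W f] by simp
  also have "\<dots> = sn_bracket (pv_fun f) (pv_vec V) \<and>\<^sub>W pv_vec W - pv_vec V \<and>\<^sub>W sn_bracket (pv_fun f) (pv_vec W)"
    using sn_bracket_leibniz[OF pv_deg_fun pv_deg_vec, of f V "pv_vec W"] by simp
  finally show ?thesis
    using wedge_diff_right[of "pv_vec V" 0]
    by (simp add: sn_bracket_fun_vec wedge_uminus_left wedge_fun_left wedge_fun_right)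
qed

lemma sn_bracket_bivec_vec:
  assumes "lie_bracket U V = 0" "lie_bracket U W = 0"
  shows "sn_bracket (pv_vec V \<and>\<^sub>W pv_vec W) (pv_vec U) = 0"
proof -
  have "sn_bracket (pv_vec U) (pv_vec V \<and>\<^sub>W pv_vec W) = 0"
    unfolding sn_bracket_leibniz[OF pv_deg_vec pv_deg_vec] by (simp add: sn_bracket_vec_vec assms)
  then show ?thesis
    using sn_bracket_antisym[OF pv_deg_wedge_vec_vec pv_deg_vec, of V W U] by simp
qed

lemma sn_bracket_scale_right:
  "P \<in> pv_deg p \<Longrightarrow> sn_bracket P (f *s Q) = sn_bracket P (pv_fun f) \<and>\<^sub>W Q + f *s sn_bracket P Q"
  using sn_bracket_leibniz[OF _ pv_deg_fun, of P p f Q] by (simp add: wedge_fun_left)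

lemma vf_apply_commute:
  "lie_bracket V W = 0 \<Longrightarrow> vf_apply V (vf_apply W f) = vf_apply W (vf_apply V f)"
  using vf_apply_lie_bracket[of V W f] by (simp add: vf_apply_def)

section \<open>Bivectors with constant coefficients in commuting vector fields\<close>

locale commuting_poisson =
  fixes Y :: "'n::{finite,linorder} \<Rightarrow> 'n vfield" and \<alpha> :: "'n \<Rightarrow> 'n \<Rightarrow> real"
  assumes commuting: "lie_bracket (Y i) (Y j) = 0"
    and antisym: "i < j \<Longrightarrow> \<alpha> j i = - \<alpha> i j"
begin

definition X :: "'n \<Rightarrow> 'n vfield" where
  "X i = (\<Sum>j\<in>UNIV - {i}. rconst (\<alpha> i j) *s Y j)"

definition \<Lambda> :: "'n pvec" where
  "\<Lambda> = (\<Sum>(i, j)\<in>{(i, j). i < j}. rscale (\<alpha> i j) (pv_vec (Y i) \<and>\<^sub>W pv_vec (Y j)))"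

lemma vf_apply_X: "vf_apply (X i) f = (\<Sum>j\<in>UNIV - {i}. rconst (\<alpha> i j) * vf_apply (Y j) f)"
  by (simp add: X_def vf_apply_sum_left vf_apply_scale_left)

text \<open>Each \<open>X i\<close> combines the commuting fields \<open>Y j\<close> with real
  coefficients, which pass through every derivation.\<close>

lemma vf_apply_X_commute: "vf_apply (X i) (vf_apply (X j) f) = vf_apply (X j) (vf_apply (X i) f)"
proof -
  have "vf_apply (X i) (vf_apply (X j) f) = (\<Sum>l\<in>UNIV - {j}. \<Sum>k\<in>UNIV - {i}.
      rconst (\<alpha> i k) * (rconst (\<alpha> j l) * vf_apply (Y k) (vf_apply (Y l) f)))" for i j
    by (simp add: vf_apply_X vf_apply_sum_right vf_apply_rconst_mult sum_distrib_left mult.left_commute)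
  note twice = this
  have "vf_apply (X i) (vf_apply (X j) f) = (\<Sum>k\<in>UNIV - {i}. \<Sum>l\<in>UNIV - {j}.
      rconst (\<alpha> i k) * (rconst (\<alpha> j l) * vf_apply (Y k) (vf_apply (Y l) f)))"
    unfolding twice by (rule sum.swap)
  also have "\<dots> = vf_apply (X j) (vf_apply (X i) f)"
    unfolding twice
    by (intro sum.cong refl) (simp add: mult.left_commute vf_apply_commute[OF commuting])
  finally show ?thesis .
qed

lemma pv_deg_\<Lambda>: "\<Lambda> \<in> pv_deg 2"
  unfolding \<Lambda>_def by (rule pv_deg_sum) (auto simp: rscale_def intro: pv_deg_scale pv_deg_wedge_vec_vec)

lemma sn_bracket_\<Lambda>_vec: "sn_bracket \<Lambda> (pv_vec (Y i)) = 0"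
  unfolding \<Lambda>_def sn_bracket_sum_left
  by (rule sum.neutral) (auto simp: rscale_def sn_bracket_rconst_left sn_bracket_bivec_vec commuting)

text \<open>The double sum over distinct indices is folded onto \<open>i < j\<close>. By
  antisymmetry of \<open>\<alpha>\<close>, the terms at \<open>(i, j)\<close> and
  \<open>(j, i)\<close> are the two halves of the bracket of one bivector with
  \<open>f\<close>.\<close>

lemma sn_bracket_\<Lambda>_fun: "sn_bracket \<Lambda> (pv_fun f) = (\<Sum>i\<in>UNIV. vf_apply (X i) f *s pv_vec (Y i))"
proof -
  let ?t = "\<lambda>i j. (rconst (\<alpha> i j) * vf_apply (Y j) f) *s pv_vec (Y i)"
  have t: "?t j i = - ((rconst (\<alpha> i j) * vf_apply (Y i) f) *s pv_vec (Y j))" if "i < j" for i j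
    using antisym[OF that] by (simp add: rconst_uminus)
  have "(\<Sum>i\<in>UNIV. vf_apply (X i) f *s pv_vec (Y i)) = (\<Sum>i\<in>UNIV. \<Sum>j\<in>UNIV - {i}. ?t i j)"
    by (simp add: vf_apply_X vec.scale_sum_left)
  also have "\<dots> = (\<Sum>(i, j)\<in>{(i, j). i < j} \<union> {(i, j). j < i}. ?t i j)"
    by (subst sum.Sigma) (auto intro!: sum.cong)
  also have "\<dots> = (\<Sum>(i, j)\<in>{(i, j). i < j}. ?t i j) + (\<Sum>(i, j)\<in>{(i, j). j < i}. ?t i j)"
    by (rule sum.union_disjoint) (auto simp: finite_pairs)
  also have "(\<Sum>(i, j)\<in>{(i, j). j < i}. ?t i j) = (\<Sum>(i, j)\<in>{(i, j). i < j}. ?t j i)"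
    by (rule sum.reindex_bij_witness[of _ prod.swap prod.swap]) auto
  also have "(\<Sum>(i, j)\<in>{(i, j). i < j}. ?t i j) + (\<Sum>(i, j)\<in>{(i, j). i < j}. ?t j i)
      = (\<Sum>(i, j)\<in>{(i, j). i < j}. rconst (\<alpha> i j) *s (vf_apply (Y j) f *s pv_vec (Y i) - vf_apply (Y i) f *s pv_vec (Y j)))"
    unfolding sum.distrib[symmetric]
    by (rule sum.cong) (auto simp: t vec.scale_right_diff_distrib vector_smult_assoc)
  finally show ?thesis
    by (simp add: \<Lambda>_def sn_bracket_sum_left rscale_def sn_bracket_rconst_left sn_bracket_bivec_fun
        case_prod_unfold)
qed

text \<open>Only the derivative of \<open>f\<close> survives in the Leibniz rule. Keeping
  \<open>W\<close> general lets the formula be applied twice in a row, first to \<open>W\<close> and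
  then to its wedge with some \<open>Y i\<close>.\<close>

lemma sn_bracket_\<Lambda>_scale:
  assumes "sn_bracket \<Lambda> W = 0"
  shows "sn_bracket \<Lambda> (f *s W) = (\<Sum>i\<in>UNIV. vf_apply (X i) f *s (pv_vec (Y i) \<and>\<^sub>W W))"
  by (simp add: sn_bracket_scale_right[OF pv_deg_\<Lambda>] assms sn_bracket_\<Lambda>_fun wedge_sum_left wedge_scale_left)

lemma sn_bracket_\<Lambda>_family: "sn_bracket \<Lambda> (wedge_family Y k) = 0"
  by (rule sn_bracket_wedge_family_eq_0[OF pv_deg_\<Lambda> sn_bracket_\<Lambda>_vec])

text \<open>The coefficients \<open>X\<^sub>j (X\<^sub>i f)\<close> are symmetric in \<open>i\<close> and \<open>j\<close>, the polyvectors antisymmetric.\<close>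

lemma sn_bracket_\<Lambda>_twice:
  assumes W: "sn_bracket \<Lambda> W = 0"
  shows "sn_bracket \<Lambda> (sn_bracket \<Lambda> (f *s W)) = 0"
proof (rule pvec_eq_neg_imp_0)
  have YW: "sn_bracket \<Lambda> (pv_vec (Y i) \<and>\<^sub>W W) = 0" for i
    unfolding sn_bracket_leibniz[OF pv_deg_\<Lambda> pv_deg_vec] by (simp add: sn_bracket_\<Lambda>_vec W)
  let ?t = "\<lambda>i j. vf_apply (X j) (vf_apply (X i) f) *s (pv_vec (Y j) \<and>\<^sub>W pv_vec (Y i) \<and>\<^sub>W W)"
  have t: "?t j i = - ?t i j" for i j
    using wedge_vec_left_commute[of "Y i" "Y j" W] by (simp add: vf_apply_X_commute[of i j])
  have eq: "sn_bracket \<Lambda> (sn_bracket \<Lambda> (f *s W)) = (\<Sum>i\<in>UNIV. \<Sum>j\<in>UNIV. ?t i j)"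
    by (simp add: sn_bracket_\<Lambda>_scale W YW sn_bracket_sum_right)
  also have "\<dots> = (\<Sum>i\<in>UNIV. \<Sum>j\<in>UNIV. ?t j i)"
    by (rule sum.swap)
  also have "\<dots> = (\<Sum>i\<in>UNIV. \<Sum>j\<in>UNIV. - ?t i j)"
    by (intro sum.cong refl t)
  also have "\<dots> = - (\<Sum>i\<in>UNIV. \<Sum>j\<in>UNIV. ?t i j)"
    by (simp only: sum_negf)
  finally show "sn_bracket \<Lambda> (sn_bracket \<Lambda> (f *s W)) = - sn_bracket \<Lambda> (sn_bracket \<Lambda> (f *s W))"
    by (simp only: eq)
qed

lemma sn_bracket_\<Lambda>_family_combination:
  "sn_bracket \<Lambda> (\<Sum>k\<in>K. f k *s wedge_family Y k)
    = (\<Sum>k\<in>K. \<Sum>i\<in>UNIV. vf_apply (X i) (f k) *s (pv_vec (Y i) \<and>\<^sub>W wedge_family Y k))"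
  by (simp add: sn_bracket_sum_right sn_bracket_\<Lambda>_scale sn_bracket_\<Lambda>_family)

text \<open>Both sides are real-linear in the field, so \<open>vf_apply_det\<close> for each
  \<open>Y j\<close> is enough.\<close>

lemma vf_apply_X_det: "vf_apply (X i) (det (\<chi> i. Y i)) = divergence (X i) * det (\<chi> i. Y i)"
proof -
  have "divergence (X i) = (\<Sum>j\<in>UNIV - {i}. rconst (\<alpha> i j) * divergence (Y j))"
    unfolding divergence_def X_def
    by (simp add: coeff_deriv_sum coeff_deriv_rconst_mult sum_distrib_left) (rule sum.swap)
  then show ?thesis
    by (simp add: vf_apply_X vf_apply_det commuting sum_distrib_right mult.assoc)
qed

text \<open>In the quotient rule, the derivative of the determinant reproduces the determinant and
  cancels one of its two inverse factors.\<close>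

lemma vf_apply_X_div_det:
  assumes "det (\<chi> i. Y i) \<noteq> 0"
  shows "vf_apply (X i) (inverse (det (\<chi> i. Y i)) * f)
    = inverse (det (\<chi> i. Y i)) * (vf_apply (X i) f - divergence (X i) * f)"
proof -
  let ?D = "det (\<chi> i. Y i)"
  have "inverse ?D * ?D = 1"
    using assms by simp
  moreover have "vf_apply (X i) (inverse ?D * f)
      = - inverse ?D * inverse ?D * (divergence (X i) * ?D) * f + inverse ?D * vf_apply (X i) f"
    by (simp only: vf_apply_mult vf_apply_inverse[OF assms] vf_apply_X_det)
  ultimately show ?thesis
    by algebra
qed

end


section \<open>Real cochains inside potential cochains\<close>

text \<open>Polyvectors without denominators, in all degrees at once, so that closure under wedge
  and bracket can be proved without tracking degrees.\<close>

definition mps_pvecs :: "'n::{finite,linorder} pvec set" where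
  "mps_pvecs = {A. \<forall>I. A $ I \<in> mps_coeffs}"

lemma mps_pvecs_0: "0 \<in> mps_pvecs"
  by (simp add: mps_pvecs_def)

lemma mps_pvecs_axis: "a \<in> mps_coeffs \<Longrightarrow> axis I a \<in> mps_pvecs"
  by (simp add: mps_pvecs_def axis_def)

lemma mps_pvecs_add: "A \<in> mps_pvecs \<Longrightarrow> B \<in> mps_pvecs \<Longrightarrow> A + B \<in> mps_pvecs"
  by (simp add: mps_pvecs_def mps_coeffs_add)

lemma mps_pvecs_diff: "A \<in> mps_pvecs \<Longrightarrow> B \<in> mps_pvecs \<Longrightarrow> A - B \<in> mps_pvecs"
  by (simp add: mps_pvecs_def mps_coeffs_diff)

lemma mps_pvecs_scale: "c \<in> mps_coeffs \<Longrightarrow> A \<in> mps_pvecs \<Longrightarrow> c *s A \<in> mps_pvecs"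
  by (simp add: mps_pvecs_def mps_coeffs_mult)

lemma mps_pvecs_sum: "(\<And>x. x \<in> S \<Longrightarrow> f x \<in> mps_pvecs) \<Longrightarrow> sum f S \<in> mps_pvecs"
  by (simp add: mps_pvecs_def mps_coeffs_sum)

lemma mps_pvecs_wedge: "A \<in> mps_pvecs \<Longrightarrow> B \<in> mps_pvecs \<Longrightarrow> A \<and>\<^sub>W B \<in> mps_pvecs"
  by (simp add: mps_pvecs_def wedge_def mps_coeffs_sum mps_coeffs_mult mps_coeffs_shuffle_sign)

lemma mps_pvecs_vec: "(\<And>r. V $ r \<in> mps_coeffs) \<Longrightarrow> pv_vec V \<in> mps_pvecs"
  by (simp add: pv_vec_def mps_pvecs_sum mps_pvecs_axis)

lemma mps_pvecs_wedge_family: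
  assumes "\<And>i r. Y i $ r \<in> mps_coeffs"
  shows "wedge_family Y k \<in> mps_pvecs"
proof (induction k rule: finite_linorder_min_induct[OF finite])
  case 1
  then show ?case by (simp add: pv_fun_def mps_pvecs_axis)
next
  case (2 b k)
  then show ?case
    by (simp add: wedge_family_insert_min[OF 2(2)] mps_pvecs_wedge mps_pvecs_vec assms)
qed

lemma mps_pvecs_sn_bracket: "A \<in> mps_pvecs \<Longrightarrow> B \<in> mps_pvecs \<Longrightarrow> sn_bracket A B \<in> mps_pvecs"
proof -
  have "pv_deriv i A \<in> mps_pvecs" "contract_left i A \<in> mps_pvecs" "contract_right i A \<in> mps_pvecs"
    if "A \<in> mps_pvecs" for i and A :: "'a pvec"
    using that by (simp_all add: mps_pvecs_def pv_deriv_def contract_left_def contract_right_def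
        mps_coeffs_coeff_deriv mps_coeffs_mult mps_coeffs_shuffle_sign)
  then show "A \<in> mps_pvecs \<Longrightarrow> B \<in> mps_pvecs \<Longrightarrow> sn_bracket A B \<in> mps_pvecs"
    by (simp add: sn_bracket_def mps_pvecs_sum mps_pvecs_diff mps_pvecs_wedge)
qed

lemma pv_deg_expand: "A \<in> pv_deg p \<Longrightarrow> A = (\<Sum>k | card k = p. axis k (A $ k))"
  by (auto simp: vec_eq_iff pv_deg_def axis_def if_distrib cong: if_cong)

text \<open>Wedges of the coordinate fields are the standard basis, so membership is decided
  component by component.\<close>

lemma real_cochains_eq:
  "real_cochains p = (pv_deg p \<inter> mps_pvecs :: 'n::{finite,linorder} pvec set)"
proof (intro equalityI subsetI)
  fix A :: "'n pvec"
  assume "A \<in> real_cochains p"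
  then obtain f where "A = (\<Sum>k | card k = p. of_mps (f k) *s axis k 1)"
    by (auto simp: real_cochains_def wedge_family_axis)
  then show "A \<in> pv_deg p \<inter> mps_pvecs"
    by (auto intro!: pv_deg_sum pv_deg_scale pv_deg_axis mps_pvecs_sum mps_pvecs_scale mps_pvecs_axis)
next
  fix A :: "'n pvec"
  assume A: "A \<in> pv_deg p \<inter> mps_pvecs"
  then have "\<forall>k. \<exists>f. A $ k = of_mps f"
    by (auto simp: mps_pvecs_def mps_coeffs_def)
  then obtain f where f: "\<And>k. A $ k = of_mps (f k)"
    by metis
  have "A = (\<Sum>k | card k = p. of_mps (f k) *s wedge_family (\<lambda>r. axis r 1) k)"
    using A pv_deg_expand[of A p] by (simp add: wedge_family_axis f flip: axis_scale)
  then show "A \<in> real_cochains p"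
    unfolding real_cochains_def by blast
qed

text \<open>The top degree part of \<open>Y\<^sub>k \<and> Y\<^sub>-\<^sub>l\<close> vanishes unless \<open>k = l\<close>, so the signed complementary
  minors \<open>N\<close> invert the matrix of minors up to the factor \<open>det\<close>. Only one factor of \<open>det\<close> appears,
  whereas expanding each \<open>\<partial>\<^sub>j\<close> separately would give its \<open>p\<close>-th power.\<close>

lemma axis_eq_wedge_family_combination:
  fixes Y :: "'n::{finite,linorder} \<Rightarrow> 'n vfield"
  defines "N \<equiv> \<lambda>K k. shuffle_sign K (- K) * (shuffle_sign k (- k) * wedge_family Y (- k) $ (- K))"
  assumes D: "det (\<chi> i. Y i) \<noteq> 0"
  shows "axis K 1 = inverse (det (\<chi> i. Y i)) *s (\<Sum>k | card k = card K. N K k *s wedge_family Y k)"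
proof -
  let ?D = "det (\<chi> i. Y i)"
  define M :: "'n coeff ^ 'n set ^ 'n set" where "M = (\<chi> k. wedge_family Y k)"
  define N' :: "'n coeff ^ 'n set ^ 'n set" where "N' = (\<chi> K k. inverse ?D * N K k)"
  have "(\<Sum>K\<in>UNIV. wedge_family Y k $ K * N K l) = (if k = l then ?D else 0)" for k l
  proof -
    \<comment> \<open>The component at \<open>UNIV\<close> of a wedge sums over all complementary
      pairs \<open>K\<close>, \<open>- K\<close>, with exactly the shuffle sign that is built into
      \<open>N\<close>.\<close>
    have "(\<Sum>K\<in>UNIV. wedge_family Y k $ K * N K l)
        = shuffle_sign l (- l) * (wedge_family Y k \<and>\<^sub>W wedge_family Y (- l)) $ UNIV"
      by (simp add: wedge_def N_def sum_distrib_left Compl_eq_Diff_UNIV ac_simps)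
    also have "\<dots> = shuffle_sign l (- l) * shuffle_sign k (- l) * wedge_family Y (k \<union> - l) $ UNIV"
      by (simp add: wedge_family_wedge)
    also have "\<dots> = (if k = l then ?D else 0)"
    proof -
      \<comment> \<open>For distinct \<open>k\<close> and \<open>l\<close>, either \<open>k\<close>
        meets \<open>- l\<close> and the sign is 0, or the union is proper and its wedge has too low
        a degree for a component at \<open>UNIV\<close>.\<close>
      consider "k = l" | "k \<inter> - l \<noteq> {}" | "k \<union> - l \<noteq> UNIV"
        by blast
      then show ?thesis
      proof cases
        case 1
        then show ?thesis
          by (simp add: wedge_family_UNIV shuffle_sign_square axis_def)
      next
        case 2
        then show ?thesis
          by (auto simp: shuffle_sign_def)
      next
        case 3
        then have "card (k \<union> - l) \<noteq> card (UNIV :: 'n set)"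
          by (meson card_subset_eq finite subset_UNIV)
        then have "wedge_family Y (k \<union> - l) $ UNIV = 0"
          using pv_deg_family[of Y "k \<union> - l"] by (auto simp: pv_deg_def)
        then show ?thesis
          using 3 by auto
      qed
    qed
    finally show ?thesis .
  qed
  then have "M ** N' = mat 1"
    using D by (simp add: vec_eq_iff matrix_matrix_mult_def M_def N'_def mat_def
        mult.left_commute flip: sum_distrib_left)
  \<comment> \<open>Both matrices are square, indexed by all subsets, over a field, so the right
    inverse is a left inverse. Its row \<open>K\<close> expresses \<open>axis K 1\<close> through
    the wedges of the \<open>Y i\<close>.\<close>
  then have "N' ** M = mat 1"
    by (simp add: matrix_left_right_inverse)
  then have "(\<Sum>k\<in>UNIV. N' $ K $ k * M $ k $ L) = (if K = L then 1 else 0)" for L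
    by (simp add: vec_eq_iff matrix_matrix_mult_def mat_def)
  then have "axis K 1 = (\<Sum>k\<in>UNIV. (inverse ?D * N K k) *s wedge_family Y k)"
    by (simp add: vec_eq_iff axis_def M_def N'_def eq_commute[of K])
  also have "\<dots> = (\<Sum>k | card k = card K. (inverse ?D * N K k) *s wedge_family Y k)"
  proof (rule sum.mono_neutral_right)
    \<comment> \<open>When \<open>k\<close> and \<open>K\<close> differ in size, so do their
      complements, and the complementary minor vanishes by degree.\<close>
    show "\<forall>k\<in>UNIV - {k. card k = card K}. (inverse ?D * N K k) *s wedge_family Y k = 0"
    proof
      fix k :: "'n set"
      assume "k \<in> UNIV - {k. card k = card K}"
      moreover have "card (- A) + card A = card (UNIV :: 'n set)" for A :: "'n set"
        using card_Un_disjoint[of "- A" A] by simp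
      note this[of K] this[of k]
      ultimately have "card (- k) \<noteq> card (- K)"
        by auto
      then have "wedge_family Y (- k) $ (- K) = 0"
        using pv_deg_family[of Y "- k"] by (auto simp: pv_deg_def)
      then show "(inverse ?D * N K k) *s wedge_family Y k = 0"
        by (simp add: N_def)
    qed
  qed auto
  finally show ?thesis
    by (simp add: vec.scale_sum_right vector_smult_assoc)
qed

lemma potential_cochainsI:
  assumes "\<And>k. c k \<in> mps_coeffs"
  shows "inverse (of_mps D) *s (\<Sum>k | card k = p. c k *s wedge_family Y k) \<in> potential_cochains D Y p"
proof -
  have "\<forall>k. \<exists>f. c k = of_mps f"
    using assms by (auto simp: mps_coeffs_def)
  then obtain f where "\<And>k. c k = of_mps (f k)"
    by metis
  then show ?thesis
    by (auto simp: potential_cochains_def potential_cochain_def)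
qed

lemma real_cochains_subset_potential_cochains:
  fixes Y :: "'n::{finite,linorder} \<Rightarrow> 'n vfield"
  assumes Y: "\<And>i r. Y i $ r \<in> mps_coeffs"
    and D: "of_mps D = det (\<chi> i. Y i)" "D \<noteq> 0"
  shows "real_cochains p \<subseteq> potential_cochains D Y p"
proof
  fix A :: "'n pvec"
  assume A: "A \<in> real_cochains p"
  define N where "N K k = shuffle_sign K (- K) * (shuffle_sign k (- k) * wedge_family Y (- k) $ (- K))"
    for K k :: "'n set"
  \<comment> \<open>The minors are components of wedges of fields without denominators, so the only
    denominator in the expansion is the single factor \<open>D\<close>.\<close>
  have N: "N K k \<in> mps_coeffs" for K k
    using mps_pvecs_wedge_family[of Y, OF Y]
    by (simp add: N_def mps_pvecs_def mps_coeffs_mult mps_coeffs_shuffle_sign)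
  have "det (\<chi> i. Y i) \<noteq> 0"
    using D by (simp flip: D(1))
  note axis = axis_eq_wedge_family_combination[of Y, OF this, folded N_def D(1)]
  have "A = (\<Sum>K | card K = p. A $ K *s axis K 1)"
    using A pv_deg_expand[of A p] by (simp add: real_cochains_eq flip: axis_scale)
  also have "\<dots> = (\<Sum>K | card K = p. inverse (of_mps D) *s (\<Sum>k | card k = p. (A $ K * N K k) *s wedge_family Y k))"
    by (intro sum.cong refl)
      (simp add: axis vec.scale_left_commute[of "A $ _"] vec.scale_sum_right vector_smult_assoc ac_simps)
  also have "\<dots> = inverse (of_mps D) *s (\<Sum>k | card k = p. (\<Sum>K | card K = p. A $ K * N K k) *s wedge_family Y k)"
    unfolding vec.scale_sum_right[symmetric] vec.scale_sum_left by (subst sum.swap) (rule refl)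
  also have "\<dots> \<in> potential_cochains D Y p"
    using A N by (intro potential_cochainsI mps_coeffs_sum mps_coeffs_mult)
      (auto simp: real_cochains_eq mps_pvecs_def)
  finally show "A \<in> potential_cochains D Y p" .
qed

text \<open>Regroups the sum by the resulting index set: a pair \<open>(k, i)\<close> with
  \<open>i\<close> outside \<open>k\<close> corresponds to \<open>l = insert i k\<close> with a
  marked element. Pairs with \<open>i\<close> in \<open>k\<close> carry the sign 0.\<close>

lemma sum_wedge_vec_family:
  "(\<Sum>k | card k = p. \<Sum>i\<in>UNIV. c i k *s (pv_vec (Y i) \<and>\<^sub>W wedge_family Y k))
    = (\<Sum>l | card l = p + 1. (\<Sum>i\<in>l. shuffle_sign {i} (l - {i}) * c i (l - {i})) *s wedge_family Y l)"
proof -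
  let ?t = "\<lambda>(k, i). (shuffle_sign {i} k * c i k) *s wedge_family Y (insert i k)"
  have "(\<Sum>k | card k = p. \<Sum>i\<in>UNIV. c i k *s (pv_vec (Y i) \<and>\<^sub>W wedge_family Y k))
      = (\<Sum>x\<in>{k. card k = p} \<times> UNIV. ?t x)"
    by (simp add: wedge_vec_family vector_smult_assoc mult.commute sum.cartesian_product case_prod_unfold)
  also have "\<dots> = (\<Sum>x\<in>(SIGMA k:{k. card k = p}. - k). ?t x)"
    by (rule sum.mono_neutral_right) (auto simp: shuffle_sign_def)
  also have "\<dots> = (\<Sum>(l, i)\<in>(SIGMA l:{l. card l = p + 1}. l). ?t (l - {i}, i))"
    by (rule sum.reindex_bij_witness[of _ "\<lambda>(l, i). (l - {i}, i)" "\<lambda>(k, i). (insert i k, i)"])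
      (auto simp: insert_absorb)
  also have "\<dots> = (\<Sum>l | card l = p + 1. \<Sum>i\<in>l. ?t (l - {i}, i))"
    by (rule sum.Sigma[symmetric]) auto
  also have "\<dots> = (\<Sum>l | card l = p + 1. (\<Sum>i\<in>l. shuffle_sign {i} (l - {i}) * c i (l - {i})) *s wedge_family Y l)"
    by (simp add: vec.scale_sum_left insert_absorb)
  finally show ?thesis .
qed

section \<open>Homogeneous parts and first-order operators with linear coefficients\<close>

lemma total_degree_single [simp]: "total_degree (Poly_Mapping.single i c) = c"
  by (simp add: total_degree_def lookup_single when_def)

lemma total_degree_eq_0_iff: "total_degree m = 0 \<longleftrightarrow> m = 0"
  by (auto simp: total_degree_def intro: poly_mapping_eqI)

lemma hom_polys_sum: "(\<And>x. x \<in> A \<Longrightarrow> f x \<in> hom_polys r) \<Longrightarrow> sum f A \<in> hom_polys r"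
  by (induction A rule: infinite_finite_induct)
    (auto simp: hom_polys_def zero_mps.rep_eq plus_mps.rep_eq, metis add_0)

lemma hom_polys_const_mult: "f \<in> hom_polys r \<Longrightarrow> mps_const c * f \<in> hom_polys r"
  by (auto simp: hom_polys_def mps_const_mult_nth)

text \<open>Describes homogeneity as being fixed by a projection, so an operator that commutes with
  the projection preserves the degree.\<close>

lemma mps_hom_part_eq_iff: "mps_hom_part r f = f \<longleftrightarrow> f \<in> hom_polys r"
proof
  assume hom: "mps_hom_part r f = f"
  have "total_degree m = r" if "mps_nth f m \<noteq> 0" for m
    using arg_cong[OF hom, of "\<lambda>g. mps_nth g m"] that
    by (simp add: mps_hom_part.rep_eq split: if_splits)
  then show "f \<in> hom_polys r"
    by (simp add: hom_polys_def)
qed (auto simp: hom_polys_def mps_hom_part.rep_eq intro!: mps_eqI)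

lemma mps_hom_part_diff: "mps_hom_part r (f - g) = mps_hom_part r f - mps_hom_part r g"
  by (rule mps_eqI) (simp add: mps_hom_part.rep_eq minus_mps.rep_eq)

lemma mps_hom_part_sum:
  fixes f :: "'a \<Rightarrow> 'n::{finite,linorder} mps"
  shows "mps_hom_part r (sum f A) = (\<Sum>x\<in>A. mps_hom_part r (f x))"
proof -
  have "mps_hom_part r 0 = 0" "mps_hom_part r (f + g) = mps_hom_part r f + mps_hom_part r g" for f g :: "'n mps"
    by (rule mps_eqI, simp add: mps_hom_part.rep_eq zero_mps.rep_eq plus_mps.rep_eq)+
  then show ?thesis
    by (induction A rule: infinite_finite_induct) simp_all
qed

lemma mps_hom_part_const_mult: "mps_hom_part r (mps_const c * f) = mps_const c * mps_hom_part r f"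
  by (rule mps_eqI) (simp add: mps_hom_part.rep_eq mps_const_mult_nth)

text \<open>The derivative lowers the degree by one and the linear factor raises it again.\<close>

lemma mps_hom_part_linear_mult_deriv:
  assumes l: "l \<in> hom_polys 1"
  shows "mps_hom_part r (l * mps_deriv i f) = l * mps_deriv i (mps_hom_part r f)"
proof (rule mps_eqI)
  fix m
  have "mps_nth (mps_hom_part r (l * mps_deriv i f)) m
      = (\<Sum>(a, b)\<in>{(a, b). a + b = m}. if total_degree m = r then mps_nth l a * mps_nth (mps_deriv i f) b else 0)"
    by (simp add: mps_hom_part.rep_eq times_mps.rep_eq)
  also have "\<dots> = mps_nth (l * mps_deriv i (mps_hom_part r f)) m"
    unfolding times_mps.rep_eq
  proof (rule sum.cong[OF refl], clarify)
    fix a b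
    assume "m = a + b"
    \<comment> \<open>A nonzero coefficient of \<open>l\<close> sits in degree 1, so the exponent
      that the derivative reads has the same degree as \<open>a + b\<close>.\<close>
    have "total_degree (b + Poly_Mapping.single i 1) = total_degree (a + b)" if "mps_nth l a \<noteq> 0"
      using l that by (simp add: hom_polys_def total_degree_add)
    then show "(if total_degree (a + b) = r then mps_nth l a * mps_nth (mps_deriv i f) b else 0)
        = mps_nth l a * mps_nth (mps_deriv i (mps_hom_part r f)) b"
      by (cases "mps_nth l a = 0") (simp_all add: mps_deriv.rep_eq mps_hom_part.rep_eq)
  qed
  finally show "mps_nth (mps_hom_part r (l * mps_deriv i f)) m
      = mps_nth (l * mps_deriv i (mps_hom_part r f)) m" .
qed

text \<open>The derivative of a linear form is a constant, read off at exponent 0. This makes the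
  divergences real numbers.\<close>

lemma mps_deriv_linear:
  assumes "f \<in> hom_polys 1"
  shows "mps_deriv i f = mps_const (mps_nth (mps_deriv i f) 0)"
proof (rule mps_eqI)
  fix m
  show "mps_nth (mps_deriv i f) m = mps_nth (mps_const (mps_nth (mps_deriv i f) 0)) m"
  proof (cases "m = 0")
    case False
    then have "total_degree (m + Poly_Mapping.single i 1) \<noteq> 1"
      by (simp add: total_degree_add total_degree_eq_0_iff)
    then show ?thesis
      using assms False by (auto simp: mps_deriv.rep_eq mps_const.rep_eq hom_polys_def)
  qed (simp add: mps_const.rep_eq)
qed


section \<open>The complexes\<close>

text \<open>Additivity and real homogeneity hold for every bracket operator, so only the subspaces,
  the degree shift and the vanishing square remain.\<close>

lemma cochain_complex_sn_bracketI:
  assumes "\<And>p. pvec.subspace (C p)"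
    and "\<And>p A. A \<in> C p \<Longrightarrow> sn_bracket P A \<in> C (p + 1)"
    and "\<And>p A. A \<in> C p \<Longrightarrow> sn_bracket P (sn_bracket P A) = 0"
  shows "cochain_complex C (sn_bracket P)"
  using assms by (simp add: cochain_complex_def sn_bracket_add_right rscale_def sn_bracket_rconst_right)

lemma subspace_potential_cochains: "pvec.subspace (potential_cochains D Y p)"
proof (rule pvec.subspaceI)
  have "potential_cochain D Y p (\<lambda>_. 0) = 0"
    by (simp add: potential_cochain_def)
  then show "0 \<in> potential_cochains D Y p"
    unfolding potential_cochains_def by (metis rangeI)
next
  fix A B
  assume "A \<in> potential_cochains D Y p" "B \<in> potential_cochains D Y p"
  then obtain f g where "A = potential_cochain D Y p f" "B = potential_cochain D Y p g"
    by (auto simp: potential_cochains_def)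
  then have "A + B = potential_cochain D Y p (\<lambda>k. f k + g k)"
    by (simp add: potential_cochain_def of_mps_add vec.scale_left_distrib vec.scale_right_distrib sum.distrib)
  then show "A + B \<in> potential_cochains D Y p"
    by (simp add: potential_cochains_def)
next
  fix c A
  assume "A \<in> potential_cochains D Y p"
  then obtain f where "A = potential_cochain D Y p f"
    by (auto simp: potential_cochains_def)
  then have "rscale c A = potential_cochain D Y p (\<lambda>k. mps_const c * f k)"
    by (simp add: potential_cochain_def of_mps_mult rscale_def rconst_def vec.scale_sum_right
        vector_smult_assoc ac_simps)
  then show "rscale c A \<in> potential_cochains D Y p"
    by (simp add: potential_cochains_def)
qed

lemma subspace_real_cochains: "pvec.subspace (real_cochains p)"
  by (rule pvec.subspaceI)
    (auto simp: real_cochains_eq rscale_def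
      intro: mps_pvecs_0 pv_deg_add mps_pvecs_add pv_deg_scale mps_pvecs_scale)

lemma potential_cochains_subset_pv_deg: "potential_cochains D Y p \<subseteq> pv_deg p"
  unfolding potential_cochains_def potential_cochain_def
  using pv_deg_family[of Y] by (auto intro!: pv_deg_scale pv_deg_sum)

lemma potential_cochain_cong:
  "(\<And>k. card k = p \<Longrightarrow> f k = g k) \<Longrightarrow> potential_cochain D Y p f = potential_cochain D Y p g"
  by (simp add: potential_cochain_def)

section \<open>Potential and real complexes of linear commuting fields\<close>

locale linear_poisson =
  fixes ell :: "'n mps ^ ('n :: {finite,linorder}) ^ ('n :: {finite,linorder})" and Y :: "'n \<Rightarrow> 'n vfield" and \<alpha> :: "'n \<Rightarrow> 'n \<Rightarrow> real"
  assumes linear: "ell $ i $ r \<in> hom_polys 1"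
    and Y: "Y i = (\<chi> r. of_mps (ell $ i $ r))"
    and Y_commuting: "lie_bracket (Y i) (Y j) = 0"
    and \<alpha>_antisym: "i < j \<Longrightarrow> \<alpha> j i = - \<alpha> i j"
    and det_nonzero: "det ell \<noteq> 0"
begin

sublocale commuting_poisson Y \<alpha>
  by unfold_locales (simp_all add: Y_commuting \<alpha>_antisym)

text \<open>The components of \<open>X i\<close> before the passage to fractions, where homogeneity
  makes sense.\<close>

definition X_mps :: "'n \<Rightarrow> 'n \<Rightarrow> 'n mps" where
  "X_mps i r = (\<Sum>j\<in>UNIV - {i}. mps_const (\<alpha> i j) * ell $ j $ r)"

text \<open>The divergence of \<open>X i\<close> as a real number: the differentiated components are
  constant series, evaluated at exponent 0.\<close>

definition \<delta> :: "'n \<Rightarrow> real" where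
  "\<delta> i = (\<Sum>r\<in>UNIV. mps_nth (mps_deriv r (X_mps i r)) 0)"

definition twisted :: "'n \<Rightarrow> 'n mps \<Rightarrow> 'n mps" where
  "twisted i f = (\<Sum>r\<in>UNIV. X_mps i r * mps_deriv r f) - mps_const (\<delta> i) * f"

text \<open>The differential as an operation on coefficient families alone: the coefficient at
  \<open>l\<close> collects every way of writing the wedge over \<open>l\<close> as one factor
  \<open>Y i\<close> times the rest.\<close>

definition potential_differential :: "('n set \<Rightarrow> 'n mps) \<Rightarrow> 'n set \<Rightarrow> 'n mps" where
  "potential_differential f l = (\<Sum>i\<in>l. mps_const (shuffle_const {i} (l - {i})) * twisted i (f (l - {i})))"

lemma of_mps_det_ell: "of_mps (det ell) = det (\<chi> i. Y i)"
  by (simp add: of_mps_det Y)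

lemma X_nth: "X i $ r = of_mps (X_mps i r)"
  by (simp add: X_def X_mps_def Y of_mps_sum of_mps_mult rconst_def)

lemma X_mps_linear: "X_mps i r \<in> hom_polys 1"
  unfolding X_mps_def by (intro hom_polys_sum hom_polys_const_mult linear)

lemma divergence_X: "divergence (X i) = rconst (\<delta> i)"
proof -
  have "coeff_deriv r (X i $ r) = rconst (mps_nth (mps_deriv r (X_mps i r)) 0)" for r
    unfolding X_nth coeff_deriv_of_mps rconst_def by (subst mps_deriv_linear[OF X_mps_linear]) (rule refl)
  then show ?thesis
    by (simp add: divergence_def \<delta>_def rconst_sum)
qed

lemma of_mps_twisted: "of_mps (twisted i f) = vf_apply (X i) (of_mps f) - divergence (X i) * of_mps f"
  by (simp add: twisted_def of_mps_diff of_mps_sum of_mps_mult vf_apply_def X_nth coeff_deriv_of_mps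
      divergence_X rconst_def)

lemma mps_hom_part_twisted: "mps_hom_part r (twisted i f) = twisted i (mps_hom_part r f)"
  by (simp add: twisted_def mps_hom_part_diff mps_hom_part_sum mps_hom_part_const_mult
      mps_hom_part_linear_mult_deriv[OF X_mps_linear])

lemma potential_differential_hom_part:
  "potential_differential (mps_hom_part r \<circ> f) = mps_hom_part r \<circ> potential_differential f"
  by (simp add: fun_eq_iff potential_differential_def mps_hom_part_sum mps_hom_part_const_mult mps_hom_part_twisted)

lemma potential_differential_hom:
  assumes "\<And>k. f k \<in> hom_polys r"
  shows "potential_differential f l \<in> hom_polys r"
proof -
  have "mps_hom_part r \<circ> f = f"
    using assms by (simp add: fun_eq_iff mps_hom_part_eq_iff)
  then show ?thesis
    using potential_differential_hom_part[of r f] by (metis comp_apply mps_hom_part_eq_iff)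
qed

lemma sn_bracket_\<Lambda>_potential_cochain_eq_vf_apply:
  "sn_bracket \<Lambda> (potential_cochain (det ell) Y p f) = (\<Sum>k | card k = p. \<Sum>i\<in>UNIV.
     vf_apply (X i) (inverse (of_mps (det ell)) * of_mps (f k)) *s (pv_vec (Y i) \<and>\<^sub>W wedge_family Y k))"
  by (simp add: potential_cochain_def vec.scale_sum_right vector_smult_assoc sn_bracket_\<Lambda>_family_combination)

lemma sn_bracket_\<Lambda>_potential_cochain_eq_divergence:
  "sn_bracket \<Lambda> (potential_cochain (det ell) Y p f) = inverse (of_mps (det ell)) *s
     (\<Sum>k | card k = p. \<Sum>i\<in>UNIV. (vf_apply (X i) (of_mps (f k)) - divergence (X i) * of_mps (f k))
       *s (pv_vec (Y i) \<and>\<^sub>W wedge_family Y k))"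
proof -
  have "vf_apply (X i) (inverse (of_mps (det ell)) * g)
      = inverse (of_mps (det ell)) * (vf_apply (X i) g - divergence (X i) * g)" for i g
    by (rule vf_apply_X_div_det[folded of_mps_det_ell]) (simp add: det_nonzero)
  then show ?thesis
    unfolding sn_bracket_\<Lambda>_potential_cochain_eq_vf_apply vec.scale_sum_right
    by (simp only: vector_smult_assoc)
qed

text \<open>Regrouping the divergence form of the bracket by index sets restores the shape of a
  potential cochain.\<close>

lemma sn_bracket_\<Lambda>_potential_cochain:
  "sn_bracket \<Lambda> (potential_cochain (det ell) Y p f)
    = potential_cochain (det ell) Y (p + 1) (potential_differential f)"
  unfolding sn_bracket_\<Lambda>_potential_cochain_eq_divergence of_mps_twisted[symmetric] sum_wedge_vec_family
  by (simp add: potential_cochain_def potential_differential_def of_mps_sum of_mps_mult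
      shuffle_sign_eq_rconst rconst_def)

lemma sn_bracket_\<Lambda>_hom_potential_cochains:
  "A \<in> hom_potential_cochains (det ell) Y p r \<Longrightarrow> sn_bracket \<Lambda> A \<in> hom_potential_cochains (det ell) Y (p + 1) r"
  unfolding hom_potential_cochains_def
  using potential_differential_hom sn_bracket_\<Lambda>_potential_cochain by blast

lemma cochain_complex_potential_cochains:
  "cochain_complex (potential_cochains (det ell) Y) (sn_bracket \<Lambda>)"
proof (rule cochain_complex_sn_bracketI)
  fix p A
  assume "A \<in> potential_cochains (det ell) Y p"
  then obtain f where A: "A = potential_cochain (det ell) Y p f"
    by (auto simp: potential_cochains_def)
  show "sn_bracket \<Lambda> A \<in> potential_cochains (det ell) Y (p + 1)"
    by (simp only: A sn_bracket_\<Lambda>_potential_cochain potential_cochains_def rangeI)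
  show "sn_bracket \<Lambda> (sn_bracket \<Lambda> A) = 0"
    by (simp add: A potential_cochain_def vec.scale_sum_right vector_smult_assoc sn_bracket_sum_right
        sn_bracket_\<Lambda>_twice sn_bracket_\<Lambda>_family)
qed (rule subspace_potential_cochains)

lemma Y_nth_mps_coeffs: "Y i $ r \<in> mps_coeffs"
  by (simp add: Y)

lemma \<Lambda>_mps_pvecs: "\<Lambda> \<in> mps_pvecs"
  unfolding \<Lambda>_def rscale_def
  by (intro mps_pvecs_sum)
    (auto intro!: mps_pvecs_scale mps_pvecs_wedge mps_pvecs_vec Y_nth_mps_coeffs)

text \<open>Square zero and the degree of the bracket are inherited from the potential complex; that
  no denominators appear follows from closure of \<open>mps_pvecs\<close> under the bracket.\<close>

lemma cochain_subcomplex_real_cochains: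
  "cochain_subcomplex real_cochains (potential_cochains (det ell) Y) (sn_bracket \<Lambda>)"
proof -
  note P = cochain_complex_potential_cochains
  have sub: "real_cochains p \<subseteq> potential_cochains (det ell) Y p" for p
    by (rule real_cochains_subset_potential_cochains[OF Y_nth_mps_coeffs of_mps_det_ell det_nonzero])
  have "cochain_complex real_cochains (sn_bracket \<Lambda>)"
  proof (rule cochain_complex_sn_bracketI)
    fix p and A :: "'n pvec"
    assume A: "A \<in> real_cochains p"
    then have "sn_bracket \<Lambda> A \<in> potential_cochains (det ell) Y (p + 1)"
      and zero: "sn_bracket \<Lambda> (sn_bracket \<Lambda> A) = 0"
      using P sub[of p] by (auto simp: cochain_complex_def)
    then show "sn_bracket \<Lambda> A \<in> real_cochains (p + 1)"
      using A potential_cochains_subset_pv_deg \<Lambda>_mps_pvecs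
      by (auto simp: real_cochains_eq intro: mps_pvecs_sn_bracket)
    show "sn_bracket \<Lambda> (sn_bracket \<Lambda> A) = 0"
      by (rule zero)
  qed (rule subspace_real_cochains)
  then show ?thesis
    using P sub by (simp add: cochain_subcomplex_def)
qed

end

theorem theorem4:
  fixes ell :: "'n mps ^ ('n :: {finite,linorder}) ^ ('n :: {finite,linorder})"
    and D :: "'n mps"
    and Y X :: "'n \<Rightarrow> 'n vfield"
    and \<alpha> :: "'n \<Rightarrow> 'n \<Rightarrow> real"
    and \<delta> :: "'n \<Rightarrow> 'n coeff"
    and \<Lambda> :: "'n pvec"
    and d\<Lambda> :: "'n pvec \<Rightarrow> 'n pvec"
  assumes linear: "\<And>i r. ell $ i $ r \<in> hom_polys 1"
    and Y: "\<And>i. Y i = (\<chi> r. of_mps (ell $ i $ r))"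
    and commuting: "\<And>i j. lie_bracket (Y i) (Y j) = 0"
    and D: "D = det ell" "D \<noteq> 0"
    and \<alpha>: "\<And>i j. i < j \<Longrightarrow> \<alpha> j i = - \<alpha> i j"
    and \<Lambda>: "\<Lambda> = (\<Sum>(i, j)\<in>{(i, j). i < j}. rscale (\<alpha> i j) (pv_vec (Y i) \<and>\<^sub>W pv_vec (Y j)))"
    and X: "\<And>i. X i = (\<Sum>j\<in>UNIV - {i}. rconst (\<alpha> i j) *s Y j)"
    and \<delta>: "\<And>i. \<delta> i = divergence (X i)"
    and d\<Lambda>: "d\<Lambda> = sn_bracket \<Lambda>"
  shows "(\<forall>i. \<delta> i \<in> range rconst) \<and>
    (\<forall>p r P C. (\<forall>k. card k = p \<longrightarrow> P k \<in> hom_polys r) \<longrightarrow> C = potential_cochain D Y p P \<longrightarrow>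
       d\<Lambda> C = (\<Sum>k | card k = p. \<Sum>i\<in>UNIV.
         vf_apply (X i) (inverse (of_mps D) * of_mps (P k)) *s (pv_vec (Y i) \<and>\<^sub>W wedge_family Y k)) \<and>
       d\<Lambda> C = inverse (of_mps D) *s (\<Sum>k | card k = p. \<Sum>i\<in>UNIV.
         (vf_apply (X i) (of_mps (P k)) - \<delta> i * of_mps (P k)) *s (pv_vec (Y i) \<and>\<^sub>W wedge_family Y k)) \<and>
       d\<Lambda> C \<in> hom_potential_cochains D Y (p + 1) r) \<and>
    (cochain_complex (potential_cochains D Y) d\<Lambda>) \<and>
    (\<forall>p r. d\<Lambda> ` hom_potential_cochains D Y p r \<subseteq> hom_potential_cochains D Y (p + 1) r) \<and>
    (\<forall>p f. \<exists>g. d\<Lambda> (potential_cochain D Y p f) = potential_cochain D Y (p + 1) g \<and>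
       (\<forall>r. d\<Lambda> (potential_cochain D Y p (mps_hom_part r \<circ> f)) =
         potential_cochain D Y (p + 1) (mps_hom_part r \<circ> g))) \<and>
    (cochain_subcomplex real_cochains (potential_cochains D Y) d\<Lambda>)"
proof -
  interpret L: linear_poisson ell Y \<alpha>
    using assms by unfold_locales simp_all
  have eqs: "X = L.X" "\<Lambda> = L.\<Lambda>" "\<delta> = (\<lambda>i. divergence (L.X i))"
    by (simp_all add: fun_eq_iff X \<Lambda> \<delta> L.X_def L.\<Lambda>_def)
  have hom: "sn_bracket L.\<Lambda> (potential_cochain (det ell) Y p P) \<in> hom_potential_cochains (det ell) Y (p + 1) r"
    if "\<forall>k. card k = p \<longrightarrow> P k \<in> hom_polys r" for p r P
  proof -
    \<comment> \<open>The hypothesis controls \<open>P k\<close> only for \<open>card k = p\<close>,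
      whereas \<open>hom_potential_cochains\<close> asks for homogeneity at every \<open>k\<close>.
      The values elsewhere do not affect the cochain and are reset to 0, which is homogeneous of
      every degree.\<close>
    have "(0 :: 'n mps) \<in> hom_polys r"
      by (simp add: hom_polys_def zero_mps.rep_eq)
    moreover have "potential_cochain (det ell) Y p P
        = potential_cochain (det ell) Y p (\<lambda>k. if card k = p then P k else 0)"
      by (rule potential_cochain_cong) simp
    ultimately have "potential_cochain (det ell) Y p P \<in> hom_potential_cochains (det ell) Y p r"
      using that unfolding hom_potential_cochains_def
      by (intro image_eqI[where x = "\<lambda>k. if card k = p then P k else 0"]) simp_all
    then show ?thesis
      by (rule L.sn_bracket_\<Lambda>_hom_potential_cochains)
  qed
  \<comment> \<open>The witness is \<open>L.potential_differential f\<close>, which commutes with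
    all homogeneous projections and so serves every \<open>r\<close> at once.\<close>
  have graded: "\<exists>g. sn_bracket L.\<Lambda> (potential_cochain (det ell) Y p f) = potential_cochain (det ell) Y (p + 1) g \<and>
      (\<forall>r. sn_bracket L.\<Lambda> (potential_cochain (det ell) Y p (mps_hom_part r \<circ> f)) =
        potential_cochain (det ell) Y (p + 1) (mps_hom_part r \<circ> g))" for p f
    using L.sn_bracket_\<Lambda>_potential_cochain L.potential_differential_hom_part by metis
  show ?thesis
    unfolding d\<Lambda> D(1) eqs
    using L.divergence_X L.sn_bracket_\<Lambda>_potential_cochain_eq_vf_apply
      L.sn_bracket_\<Lambda>_potential_cochain_eq_divergence hom L.cochain_complex_potential_cochains
      L.sn_bracket_\<Lambda>_hom_potential_cochains graded L.cochain_subcomplex_real_cochains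
    by (intro conjI allI impI) blast+
qed

end
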